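(* For each $k\in\{2,3,4,5,6\}$, the pagenumber of the complete bipartite graph $K_{k+1,\lfloor (k+1)^2/4\rfloor+1}$ is $k+1$.
   Context: A book with $k$ pages consists of a line (the spine) and $k$ half-planes (the pages) whose common boundary is the spine. A $k$-page drawing of a graph places all vertices on the spine and draws each edge inside a single page; a $k$-page embedding is a $k$-page drawing with no edge crossings. The pagenumber of a graph $G$ is the minimum $k$ such that $G$ admits a $k$-page embedding. *)

theory Defs
  imports Main
begin

text \<open>A graph is given by a finite vertex set V and a set E of edges, each edge a
2-element subset of V. A book drawing places the vertices on the spine in an order
given by an injective position map pos, and assigns each edge a page in {0..<p}.
Two edges on the same page cross iff their endpoints alternate along the spine.\<close>

definition crossing :: "('a \<Rightarrow> nat) \<Rightarrow> 'a set \<Rightarrow> 'a set \<Rightarrow> bool" where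
  "crossing pos e f \<longleftrightarrow>
     (\<exists>a b c d. e = {a, b} \<and> f = {c, d} \<and> pos a < pos c \<and> pos c < pos b \<and> pos b < pos d)"

definition book_embedding ::
  "'a set \<Rightarrow> 'a set set \<Rightarrow> nat \<Rightarrow> ('a \<Rightarrow> nat) \<Rightarrow> ('a set \<Rightarrow> nat) \<Rightarrow> bool" where
  "book_embedding V E p pos page \<longleftrightarrow>
     inj_on pos V \<and>
     (\<forall>e\<in>E. page e < p) \<and>
     (\<forall>e\<in>E. \<forall>f\<in>E. page e = page f \<longrightarrow> \<not> crossing pos e f)"

definition pagenumber :: "'a set \<Rightarrow> 'a set set \<Rightarrow> nat" where
  "pagenumber V E = (LEAST p. \<exists>pos page. book_embedding V E p pos page)"

definition Kbip_V :: "nat \<Rightarrow> nat \<Rightarrow> (nat + nat) set" where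
  "Kbip_V m n = Inl ` {0..<m} \<union> Inr ` {0..<n}"

definition Kbip_E :: "nat \<Rightarrow> nat \<Rightarrow> (nat + nat) set set" where
  "Kbip_E m n = {{Inl i, Inr j} | i j. i < m \<and> j < n}"

end

theory Submission
  imports Defs "HOL-Library.Sublist"
begin

text \<open>Giving every left vertex its own page shows that k + 1 pages suffice. For the lower bound, a
circular arrangement of the vertices is determined by the numbers of right vertices in the k + 1
gaps between consecutive left vertices. Whether its edges can be distributed over k pages does not
depend on rotation and reflection, and it is inherited by arrangements with smaller gaps. It turns out
that every gap sequence with the required sum dominates, up to rotation and reflection, one of a few
small sequences (99 in total for the five values of k), and that each of these contains few edges
that cannot be coloured: k pairwise crossing edges exhaust all pages, and then further edges are
forced one after the other, almost without branching, until one has no page left.\<close>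

section \<open>Book embeddings as circular words\<close>

text \<open>The lower bound ranges over all vertex orders and all page assignments. K_{7,13} alone
  has 27132 gap sequences (7 entries with sum 13) and 91 edges, so the two quantifiers are
  separated. Orders are handled by decision trees, whose check compares lists of numbers and never
  looks at an edge. Colourings are refuted only for the sequences at the leaves, each by a short
  list of its edges. Choosing a largest gap as the first one removes most of the rotational symmetry
  and lets an upper bound on the first entry bound all the others.\<close>

text \<open>The circular order of the vertices on the spine is a word over bool, True standing for a
vertex on the left side of the bipartition and False for one on the right side.\<close>

definition paging :: "bool list \<Rightarrow> nat \<Rightarrow> (nat \<Rightarrow> nat \<Rightarrow> nat) \<Rightarrow> bool" where
  "paging w k f \<longleftrightarrow>
     (\<forall>a b. a < b \<and> b < length w \<and> w ! a \<noteq> w ! b \<longrightarrow> f a b < k) \<and>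
     (\<forall>a b c d. a < c \<and> c < b \<and> b < d \<and> d < length w \<and> w ! a \<noteq> w ! b \<and> w ! c \<noteq> w ! d
        \<longrightarrow> f a b \<noteq> f c d)"

definition pageable :: "bool list \<Rightarrow> nat \<Rightarrow> bool" where
  "pageable w k \<longleftrightarrow> (\<exists>f. paging w k f)"

lemma pagingD:
  assumes "paging w k f"
  shows "a < b \<Longrightarrow> b < length w \<Longrightarrow> w ! a \<noteq> w ! b \<Longrightarrow> f a b < k"
    and "a < c \<Longrightarrow> c < b \<Longrightarrow> b < d \<Longrightarrow> d < length w \<Longrightarrow> w ! a \<noteq> w ! b \<Longrightarrow> w ! c \<noteq> w ! d
        \<Longrightarrow> f a b \<noteq> f c d"
  using assms unfolding paging_def by simp_all

lemma pageableI:
  assumes "\<And>a b. a < b \<Longrightarrow> b < length w \<Longrightarrow> w ! a \<noteq> w ! b \<Longrightarrow> f a b < k"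
    and "\<And>a b c d. a < c \<Longrightarrow> c < b \<Longrightarrow> b < d \<Longrightarrow> d < length w \<Longrightarrow> w ! a \<noteq> w ! b \<Longrightarrow> w ! c \<noteq> w ! d
        \<Longrightarrow> f a b \<noteq> f c d"
  shows "pageable w k"
  unfolding pageable_def paging_def using assms
  by (intro exI[of _ f] conjI allI impI; elim conjE) simp_all

lemma pageable_mono:
  assumes "pageable w k" "k \<le> l"
  shows "pageable w l"
proof -
  obtain f where f: "paging w k f" using assms(1) by (auto simp: pageable_def)
  show ?thesis
  proof (rule pageableI[of _ f])
    show "f a b < l" if "a < b" "b < length w" "w ! a \<noteq> w ! b" for a b
      using pagingD(1)[OF f that] assms(2) by simp
  qed (use pagingD(2)[OF f] in blast)
qed

section \<open>Invariance under rotation, reflection and deletion of vertices\<close>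

lemma pageable_rotate1:
  assumes "pageable (x # xs) k"
  shows "pageable (xs @ [x]) k"
proof -
  let ?n = "length xs"
  obtain f where f: "paging (x # xs) k f"
    using assms by (auto simp: pageable_def)
  note f1 = pagingD(1)[OF f] and f2 = pagingD(2)[OF f]
  \<comment> \<open>Moving the first vertex to the end shifts every other position down by one. A
    chord of the new word that ends at the last position is an old chord from position 0, so its two
    ends trade places.\<close>
  define g where "g a b = (if b < ?n then f (Suc a) (Suc b) else f 0 (Suc a))" for a b
  show ?thesis
  proof (rule pageableI[of _ g])
    fix a b assume "a < b" "b < length (xs @ [x])" "(xs @ [x]) ! a \<noteq> (xs @ [x]) ! b"
    then show "g a b < k"
      using f1[of "Suc a" "Suc b"] f1[of 0 "Suc a"]
      by (auto simp: g_def nth_append split: if_splits)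
  next
    fix a b c d
    assume A: "a < c" "c < b" "b < d" "d < length (xs @ [x])"
      "(xs @ [x]) ! a \<noteq> (xs @ [x]) ! b" "(xs @ [x]) ! c \<noteq> (xs @ [x]) ! d"
    show "g a b \<noteq> g c d"
    proof (cases "d < ?n")
      case True
      then show ?thesis
        using A f2[of "Suc a" "Suc c" "Suc b" "Suc d"] by (auto simp: g_def nth_append)
    next
      case False
      \<comment> \<open>Only the second chord can end at the moved vertex, because
        \<open>b < d\<close>. In the old word that chord starts first, so the two chords exchange
        their roles in the alternation.\<close>
      then have "d = ?n" using A by simp
      then show ?thesis
        using A f2[of 0 "Suc a" "Suc c" "Suc b"] by (auto simp: g_def nth_append)
    qed
  qed
qed

lemma pageable_append_swap: "pageable (xs @ ys) k \<Longrightarrow> pageable (ys @ xs) k"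
proof (induction xs arbitrary: ys)
  case (Cons x xs)
  then have "pageable (xs @ (ys @ [x])) k"
    using pageable_rotate1[of x "xs @ ys" k] by simp
  from Cons.IH[OF this] show ?case by simp
qed simp

text \<open>Sending position i to n - 1 - i reverses the order; alternation survives, with the two
  chords exchanged.\<close>

lemma pageable_rev:
  assumes "pageable w k"
  shows "pageable (rev w) k"
proof -
  let ?n = "length w"
  obtain f where f: "paging w k f"
    using assms by (auto simp: pageable_def)
  note f1 = pagingD(1)[OF f] and f2 = pagingD(2)[OF f]
  show ?thesis
  proof (rule pageableI[of _ "\<lambda>a b. f (?n - Suc b) (?n - Suc a)"])
    fix a b assume "a < b" "b < length (rev w)" "rev w ! a \<noteq> rev w ! b"
    then show "f (?n - Suc b) (?n - Suc a) < k"
      by (intro f1) (auto simp: rev_nth)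
  next
    fix a b c d
    assume "a < c" "c < b" "b < d" "d < length (rev w)"
      "rev w ! a \<noteq> rev w ! b" "rev w ! c \<noteq> rev w ! d"
    then have "f (?n - Suc d) (?n - Suc c) \<noteq> f (?n - Suc b) (?n - Suc a)"
      by (intro f2) (auto simp: rev_nth)
    then show "f (?n - Suc b) (?n - Suc a) \<noteq> f (?n - Suc d) (?n - Suc c)" by simp
  qed
qed

text \<open>The map \<open>h\<close> increases strictly on all natural numbers, beyond the length of
  \<open>xs\<close> as well, so that its monotonicity can be used without range conditions.\<close>

lemma subseq_embedding:
  assumes "subseq xs ys"
  obtains h :: "nat \<Rightarrow> nat" where "\<And>i j. i < j \<Longrightarrow> h i < h j"
    and "\<And>i. i < length xs \<Longrightarrow> h i < length ys \<and> ys ! h i = xs ! i"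
proof -
  have "\<exists>h :: nat \<Rightarrow> nat. (\<forall>i j. i < j \<longrightarrow> h i < h j) \<and>
      (\<forall>i < length xs. h i < length ys \<and> ys ! h i = xs ! i)"
    using assms
  proof (induction rule: list_emb.induct)
    case (list_emb_Nil ys)
    show ?case by (rule exI[of _ id]) simp
  next
    case (list_emb_Cons xs ys y)
    then obtain h :: "nat \<Rightarrow> nat" where "\<forall>i j. i < j \<longrightarrow> h i < h j"
      "\<forall>i < length xs. h i < length ys \<and> ys ! h i = xs ! i" by blast
    then show ?case by (intro exI[of _ "\<lambda>i. Suc (h i)"]) simp
  next
    case (list_emb_Cons2 x y xs ys)
    then obtain h :: "nat \<Rightarrow> nat" where "\<forall>i j. i < j \<longrightarrow> h i < h j"
      "\<forall>i < length xs. h i < length ys \<and> ys ! h i = xs ! i" by blast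
    then show ?case using \<open>x = y\<close>
      by (intro exI[of _ "\<lambda>i. case i of 0 \<Rightarrow> 0 | Suc i' \<Rightarrow> Suc (h i')"])
        (auto split: nat.split simp: less_Suc_eq_0_disj)
  qed
  then show ?thesis using that by blast
qed

text \<open>Deleting vertices cannot create a crossing, so the assignment is pulled back along the
  embedding \<open>h\<close>.\<close>

lemma pageable_subseq:
  assumes "subseq xs ys" "pageable ys k"
  shows "pageable xs k"
proof -
  obtain h :: "nat \<Rightarrow> nat" where
    h: "\<And>i j. i < j \<Longrightarrow> h i < h j" "\<And>i. i < length xs \<Longrightarrow> h i < length ys \<and> ys ! h i = xs ! i"
    using subseq_embedding[OF assms(1)] by metis
  obtain f where f: "paging ys k f"
    using assms(2) by (auto simp: pageable_def)
  note f1 = pagingD(1)[OF f] and f2 = pagingD(2)[OF f]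
  show ?thesis
  proof (rule pageableI[of _ "\<lambda>a b. f (h a) (h b)"])
    fix a b assume "a < b" "b < length xs" "xs ! a \<noteq> xs ! b"
    then show "f (h a) (h b) < k" using h by (intro f1) auto
  next
    fix a b c d
    assume "a < c" "c < b" "b < d" "d < length xs" "xs ! a \<noteq> xs ! b" "xs ! c \<noteq> xs ! d"
    then show "f (h a) (h b) \<noteq> f (h c) (h d)" using h by (intro f2) auto
  qed
qed

text \<open>Only the sides of the vertices, in spine order, survive in \<open>w\<close>. This is
  enough because the graph is complete bipartite: positions with different letters are always joined
  by an edge, so the word determines which pairs of positions are edges.\<close>

lemma book_embedding_pageable:
  assumes "book_embedding (Kbip_V m n) (Kbip_E m n) k pos page"
  obtains w where "count_list w True = m" "count_list w False = n" "pageable w k"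
proof -
  let ?V = "Kbip_V m n" and ?E = "Kbip_E m n"
  have inj: "inj_on pos ?V" and pages: "\<And>e. e \<in> ?E \<Longrightarrow> page e < k"
    and cross: "\<And>e f. e \<in> ?E \<Longrightarrow> f \<in> ?E \<Longrightarrow> page e = page f \<Longrightarrow> \<not> crossing pos e f"
    using assms by (auto simp: book_embedding_def)
  have fin: "finite ?V" by (simp add: Kbip_V_def)
  define ps where "ps = sorted_list_of_set (pos ` ?V)"
  define v where "v i = inv_into ?V pos (ps ! i)" for i
  define w where "w = map (\<lambda>x. isl (inv_into ?V pos x)) ps"
  have set_ps: "set ps = pos ` ?V" and dist: "distinct ps"
    using fin by (auto simp: ps_def)
  have v: "v i \<in> ?V" "pos (v i) = ps ! i" "w ! i = isl (v i)" if "i < length w" for i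
    using that set_ps nth_mem[of i ps]
    by (auto simp: v_def w_def inv_into_into f_inv_into_f)
  have less: "pos (v i) < pos (v j)" if "i < j" "j < length w" for i j
    using that v(2)[of i] v(2)[of j] strict_sorted_list_of_set[of "pos ` ?V"]
    by (auto simp: w_def ps_def sorted_wrt_nth_less)
  have edge: "{v i, v j} \<in> ?E" if "i < length w" "j < length w" "w ! i \<noteq> w ! j" for i j
  proof -
    have "v i \<in> ?V" "v j \<in> ?V" "isl (v i) \<noteq> isl (v j)"
      using v[OF that(1)] v[OF that(2)] that(3) by auto
    then show ?thesis
      by (cases "v i"; cases "v j") (auto simp: Kbip_V_def Kbip_E_def doubleton_eq_iff)
  qed
  \<comment> \<open>Occurrences of a letter are counted as elements of \<open>ps\<close>, which
    \<open>pos\<close> matches bijectively with the vertices on that side.\<close>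
  have count: "count_list w b = card {x \<in> ?V. isl x = b}" for b
  proof -
    have "count_list w b = length (filter (\<lambda>x. isl (inv_into ?V pos x) = b) ps)"
      by (simp add: w_def count_list_eq_length_filter filter_map o_def eq_commute)
    also have "\<dots> = card (set (filter (\<lambda>x. isl (inv_into ?V pos x) = b) ps))"
      using dist by (simp only: distinct_card distinct_filter)
    also have "set (filter (\<lambda>x. isl (inv_into ?V pos x) = b) ps) = pos ` {x \<in> ?V. isl x = b}"
      using inj by (auto simp: set_ps)
    also have "card \<dots> = card {x \<in> ?V. isl x = b}"
      by (intro card_image inj_on_subset[OF inj]) auto
    finally show ?thesis .
  qed
  have "{x \<in> ?V. isl x = True} = Inl ` {0..<m}" "{x \<in> ?V. isl x = False} = Inr ` {0..<n}"
    by (auto simp: Kbip_V_def)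
  then have "count_list w True = m" "count_list w False = n"
    by (simp_all add: count card_image inj_on_def)
  moreover have "pageable w k"
  proof (rule pageableI[of _ "\<lambda>a b. page {v a, v b}"])
    fix a b assume "a < b" "b < length w" "w ! a \<noteq> w ! b"
    then show "page {v a, v b} < k" by (intro pages edge) auto
  next
    fix a b c d
    assume A: "a < c" "c < b" "b < d" "d < length w" "w ! a \<noteq> w ! b" "w ! c \<noteq> w ! d"
    then have "crossing pos {v a, v b} {v c, v d}"
      unfolding crossing_def using less[of a c] less[of c b] less[of b d]
      by (intro exI[of _ "v a"] exI[of _ "v b"] exI[of _ "v c"] exI[of _ "v d"]) auto
    moreover have "{v a, v b} \<in> ?E" "{v c, v d} \<in> ?E"
      using A by (auto intro!: edge)
    ultimately show "page {v a, v b} \<noteq> page {v c, v d}" using cross by blast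
  qed
  ultimately show ?thesis by (rule that)
qed

section \<open>Refuting colourings by backtracking\<close>

text \<open>Symmetric, unlike the crossing condition in \<open>paging\<close>, because the search
  meets the edges in an arbitrary order.\<close>

fun chords_cross :: "nat \<times> nat \<Rightarrow> nat \<times> nat \<Rightarrow> bool" where
  "chords_cross (a, b) (c, d) \<longleftrightarrow> a < c \<and> c < b \<and> b < d \<or> c < a \<and> a < d \<and> d < b"

fun insertions :: "nat \<times> nat \<Rightarrow> (nat \<times> nat) list list \<Rightarrow> (nat \<times> nat) list list list" where
  "insertions e [] = []"
| "insertions e (c # cs) =
    (if list_ex (chords_cross e) c then map ((#) c) (insertions e cs)
     else ((e # c) # cs) # map ((#) c) (insertions e cs))"

text \<open>A state (j, cs) is a partial colouring with nonempty classes cs and j unused pages. As unused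
pages are interchangeable, an edge need only be tried on one of them.\<close>

fun extensions :: "nat \<times> nat \<Rightarrow> (nat \<times> (nat \<times> nat) list list) list \<Rightarrow>
    (nat \<times> (nat \<times> nat) list list) list" where
  "extensions e [] = []"
| "extensions e ((0, cs) # sts) = map (Pair 0) (insertions e cs) @ extensions e sts"
| "extensions e ((Suc j, cs) # sts) =
    (j, [e] # cs) # map (Pair (Suc j)) (insertions e cs) @ extensions e sts"

text \<open>The search is breadth-first: after each prefix of \<open>es\<close> the list of states
  holds a representative, up to renaming of pages, of every crossing-free colouring of that prefix
  with \<open>k\<close> pages. Once empty, it stays empty.\<close>

definition refuted :: "nat \<Rightarrow> (nat \<times> nat) list \<Rightarrow> bool" where
  "refuted k es \<longleftrightarrow> fold extensions es [(k, [])] = []"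

text \<open>\<open>extensions\<close> treats the states one by one, so a single state can be
  followed through the list.\<close>

lemma extensions_mono: "(j, cs) \<in> set sts \<Longrightarrow> set (extensions e [(j, cs)]) \<subseteq> set (extensions e sts)"
  by (induction e sts rule: extensions.induct) (cases j; auto)+

text \<open>Here \<open>f\<close> is an actual colouring and \<open>xs\<close> lists the page of
  each class. The edge \<open>e\<close> fits into the class of page \<open>f e\<close>: by the last
  assumption no member of that class crosses \<open>e\<close>.\<close>

lemma insertions_complete:
  assumes "list_all2 (\<lambda>x c. \<forall>d \<in> set c. f d = x) xs cs" "f e \<in> set xs"
    and "\<And>d. d \<in> set (concat cs) \<Longrightarrow> chords_cross e d \<Longrightarrow> f e \<noteq> f d"
  shows "\<exists>cs' \<in> set (insertions e cs).
    list_all2 (\<lambda>x c. \<forall>d \<in> set c. f d = x) xs cs' \<and> set (concat cs') = insert e (set (concat cs))"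
  using assms
proof (induction rule: list_all2_induct)
  case (Cons x xs c cs)
  show ?case
  proof (cases "f e = x")
    case True
    have "\<not> chords_cross e d" if "d \<in> set c" for d
      using that True Cons.hyps(1) Cons.prems(2)[of d] by auto
    then have "\<not> list_ex (chords_cross e) c" by (auto simp: list_ex_iff)
    then show ?thesis using True Cons.hyps by (intro bexI[of _ "(e # c) # cs"]) auto
  next
    case False
    then obtain cs' where "cs' \<in> set (insertions e cs)"
      "list_all2 (\<lambda>x c. \<forall>d \<in> set c. f d = x) xs cs'"
      "set (concat cs') = insert e (set (concat cs))"
      using Cons by auto
    then show ?thesis using Cons.hyps by (intro bexI[of _ "c # cs'"]) auto
  qed
qed simp

text \<open>The invariant is that some state in the list agrees with the colouring \<open>f\<close>:
  its classes lie on the distinct pages \<open>xs\<close>, and \<open>j\<close> counts the other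
  pages. Each edge is followed into the class, or onto the new page, where \<open>f\<close> puts it,
  so the list never becomes empty.\<close>

lemma fold_extensions_nonempty:
  assumes "(j, cs) \<in> set sts" "list_all2 (\<lambda>x c. \<forall>d \<in> set c. f d = x) xs cs"
    and "distinct xs" "set xs \<subseteq> {..<k}" "length xs + j = k"
    and "\<And>e. e \<in> set es \<Longrightarrow> f e < k"
    and "\<And>d e. d \<in> set es \<union> set (concat cs) \<Longrightarrow> e \<in> set es \<union> set (concat cs) \<Longrightarrow>
          chords_cross d e \<Longrightarrow> f d \<noteq> f e"
  shows "fold extensions es sts \<noteq> []"
  using assms
proof (induction es arbitrary: j cs xs sts)
  case Nil
  then show ?case by auto
next
  case (Cons e es)
  show ?case
  proof (cases "f e \<in> set xs")
    case True
    have "\<exists>cs' \<in> set (insertions e cs). list_all2 (\<lambda>x c. \<forall>d \<in> set c. f d = x) xs cs' \<and>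
        set (concat cs') = insert e (set (concat cs))"
      by (rule insertions_complete[OF Cons.prems(2) True]) (use Cons.prems(7) in auto)
    then obtain cs' where cs': "cs' \<in> set (insertions e cs)"
      "list_all2 (\<lambda>x c. \<forall>d \<in> set c. f d = x) xs cs'"
      "set (concat cs') = insert e (set (concat cs))" by blast
    have "(j, cs') \<in> set (extensions e [(j, cs)])" using cs'(1) by (cases j) auto
    then have "(j, cs') \<in> set (extensions e sts)" using extensions_mono[OF Cons.prems(1)] by blast
    then have "fold extensions es (extensions e sts) \<noteq> []"
    proof (rule Cons.IH[OF _ cs'(2) Cons.prems(3-5)])
      show "f d < k" if "d \<in> set es" for d using that Cons.prems(6) by simp
      show "f d \<noteq> f d'" if "d \<in> set es \<union> set (concat cs')" "d' \<in> set es \<union> set (concat cs')"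
        "chords_cross d d'" for d d'
        using that Cons.prems(7)[of d d'] unfolding cs'(3) by auto
    qed
    then show ?thesis by simp
  next
    case False
    have "f e < k" using Cons.prems(6) by simp
    then have "card (insert (f e) (set xs)) \<le> card {..<k}"
      using Cons.prems(4) by (intro card_mono) auto
    then have "Suc (length xs) \<le> k"
      using False Cons.prems(3) by (simp add: distinct_card)
    then obtain i where i: "j = Suc i" using Cons.prems(5) by (cases j) auto
    have "(i, [e] # cs) \<in> set (extensions e sts)"
      using extensions_mono[OF Cons.prems(1), of e] i by auto
    then have "fold extensions es (extensions e sts) \<noteq> []"
    proof (rule Cons.IH[of _ _ _ "f e # xs"])
      show "list_all2 (\<lambda>x c. \<forall>d \<in> set c. f d = x) (f e # xs) ([e] # cs)"
        using Cons.prems(2) by simp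
      show "distinct (f e # xs)" "set (f e # xs) \<subseteq> {..<k}" "length (f e # xs) + i = k"
        using False Cons.prems(3-5) \<open>f e < k\<close> i by auto
      show "f d < k" if "d \<in> set es" for d using that Cons.prems(6) by simp
      show "f d \<noteq> f d'" if "d \<in> set es \<union> set (concat ([e] # cs))"
        "d' \<in> set es \<union> set (concat ([e] # cs))" "chords_cross d d'" for d d'
        using that Cons.prems(7)[of d d'] by auto
    qed
    then show ?thesis by simp
  qed
qed

lemma refuted_sound:
  assumes "refuted k es" "\<And>e. e \<in> set es \<Longrightarrow> f e < k"
    and "\<And>d e. d \<in> set es \<Longrightarrow> e \<in> set es \<Longrightarrow> chords_cross d e \<Longrightarrow> f d \<noteq> f e"
  shows False
  using fold_extensions_nonempty[of k "[]" "[(k, [])]" f "[]" k es] assms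
  by (auto simp: refuted_def)

section \<open>Gap sequences\<close>

text \<open>The i-th entry of a gap sequence is the number of right vertices between the i-th left vertex
and the next one.\<close>

definition gap_word :: "nat list \<Rightarrow> bool list" where
  "gap_word gs = concat (map (\<lambda>g. True # replicate g False) gs)"

lemma gap_word_simps [simp]:
  "gap_word [] = []"
  "gap_word (g # gs) = True # replicate g False @ gap_word gs"
  "gap_word (gs @ hs) = gap_word gs @ gap_word hs"
  by (simp_all add: gap_word_def)

lemma count_list_replicate: "count_list (replicate n x) y = (if x = y then n else 0)"
  by (induction n) auto

lemma count_list_gap_word:
  "count_list (gap_word gs) True = length gs" "count_list (gap_word gs) False = sum_list gs"
  by (induction gs) (simp_all add: count_list_replicate)

text \<open>Right vertices before the first left one belong to no gap of the linear word and are
  kept apart as \<open>g\<close>; circularly they extend the last gap.\<close>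

lemma gap_word_exists: "\<exists>g gs. w = replicate g False @ gap_word gs"
proof (induction w)
  case Nil
  show ?case by (intro exI[of _ 0] exI[of _ "[]"]) simp
next
  case (Cons x w)
  then obtain g gs where w: "w = replicate g False @ gap_word gs" by blast
  show ?case
  proof (cases x)
    case True
    then show ?thesis using w by (intro exI[of _ 0] exI[of _ "g # gs"]) simp
  next
    case False
    then show ?thesis using w by (intro exI[of _ "Suc g"] exI[of _ gs]) simp
  qed
qed

lemma subseq_gap_word:
  assumes "list_all2 (\<le>) gs hs"
  shows "subseq (gap_word gs) (gap_word hs)"
  using assms
proof (induction rule: list_all2_induct)
  case (Cons g gs h hs)
  have "subseq (replicate g False) (replicate (g + i) False)" for i
    unfolding replicate_add by (rule subseq_rev_drop_many) simp
  from this[of "h - g"] show ?case using Cons by (auto intro!: list_emb_append_mono)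
qed simp

section \<open>Dihedral symmetry of gap sequences\<close>

lemma pageable_gap_word_append_swap:
  "pageable (gap_word (gs @ hs)) k \<Longrightarrow> pageable (gap_word (hs @ gs)) k"
  using pageable_append_swap by simp

lemma pageable_gap_word_rotate:
  "pageable (gap_word (rotate i gs)) k \<Longrightarrow> pageable (gap_word gs) k"
  using pageable_gap_word_append_swap
    [of "drop (i mod length gs) gs" "take (i mod length gs) gs" k]
  by (simp only: rotate_drop_take append_take_drop_id)


text \<open>Reversal puts each block of right vertices in front of its left vertex. One more left
  vertex on each side makes up for it: in front of the reversed word, and behind the gap word of the
  reversed sequence.\<close>

lemma True_rev_gap_word: "True # rev (gap_word gs) = gap_word (rev gs) @ [True]"
proof (induction gs)
  case (Cons g gs)
  have "True # rev (gap_word (g # gs)) = (True # rev (gap_word gs)) @ replicate g False @ [True]"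
    by simp
  also have "\<dots> = gap_word (rev (g # gs)) @ [True]" by (simp add: Cons.IH)
  finally show ?case .
qed simp

text \<open>By \<open>True_rev_gap_word\<close>, the reversed word arises from
  \<open>gap_word (rev gs)\<close> by moving its first letter to the end, so one rotation step and
  one reflection suffice.\<close>

lemma pageable_gap_word_rev:
  assumes "pageable (gap_word (rev gs)) k"
  shows "pageable (gap_word gs) k"
proof (cases gs)
  case (Cons g hs)
  have "rev (gap_word gs) = tl (gap_word (rev gs) @ [True])"
    by (metis True_rev_gap_word list.sel(3))
  also have "\<dots> = tl (gap_word (rev gs)) @ [True]"
    using Cons by (cases "rev gs") auto
  finally have "rev (gap_word gs) = tl (gap_word (rev gs)) @ [True]" .
  moreover have "gap_word (rev gs) = True # tl (gap_word (rev gs))"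
    using Cons by (cases "rev gs") auto
  ultimately have "pageable (rev (gap_word gs)) k"
    using pageable_rotate1 assms by metis
  from pageable_rev[OF this] show ?thesis by simp
qed (use assms in simp)

section \<open>Reduction to finitely many gap sequences\<close>

fun chord_ends :: "bool list \<Rightarrow> nat \<times> nat \<Rightarrow> bool" where
  "chord_ends w (a, b) \<longleftrightarrow> a < b \<and> b < length w \<and> w ! a \<noteq> w ! b"

text \<open>There is one gap per left vertex, so \<open>length gs - 1\<close> is k when
  \<open>gs\<close> has k + 1 entries. A list of some of the edges is enough, since a colouring of
  the whole graph restricts to it.\<close>

fun certified :: "nat list \<times> (nat \<times> nat) list \<Rightarrow> bool" where
  "certified (gs, es) \<longleftrightarrow> list_all (chord_ends (gap_word gs)) es \<and> refuted (length gs - 1) es"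

lemma not_pageable_certified:
  assumes "certified (gs, es)"
  shows "\<not> pageable (gap_word gs) (length gs - 1)"
proof
  let ?w = "gap_word gs" and ?k = "length gs - 1"
  assume "pageable ?w ?k"
  then obtain f where f: "paging ?w ?k f"
    by (auto simp: pageable_def)
  note f1 = pagingD(1)[OF f] and f2 = pagingD(2)[OF f]
  have es: "a < b \<and> b < length ?w \<and> ?w ! a \<noteq> ?w ! b" if "(a, b) \<in> set es" for a b
    using that assms by (auto simp: list_all_iff)
  have "refuted ?k es" using assms by simp
  then show False
  proof (rule refuted_sound[where f = "case_prod f"])
    fix e assume "e \<in> set es"
    then show "case_prod f e < ?k"
      using es[of "fst e" "snd e"] f1[of "fst e" "snd e"] by (simp add: case_prod_beta)
  next
    fix d e
    assume "d \<in> set es" "e \<in> set es" "chords_cross d e"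
    moreover obtain a b a' b' where "d = (a, b)" "e = (a', b')" by fastforce
    \<comment> \<open>The condition in \<open>paging\<close> fixes which chord starts first, hence
      the two instances of \<open>f2\<close>.\<close>
    ultimately show "case_prod f d \<noteq> case_prod f e"
      using es[of a b] es[of a' b'] f2[of a a' b b'] f2[of a' a b' b] by auto
  qed
qed

lemma pageable_dihedral_image:
  assumes "pageable (gap_word (rotate i (if r then rev gs else gs))) k"
  shows "pageable (gap_word gs) k"
  using pageable_gap_word_rotate[OF assms] by (cases r) (auto intro: pageable_gap_word_rev)

text \<open>A case distinction on the entries of a sequence with prescribed sum n and a largest entry in
front: Split i t distinguishes whether the i-th entry is less than t or not, and a leaf names a member
of ps some dihedral image of which is dominated.\<close>

datatype cover = Infeasible | Leaf "nat list" bool nat | Split nat nat cover cover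

text \<open>A node stands for the box of all sequences lying entrywise between \<open>lo\<close> and
  \<open>hi\<close>. A leaf inspects only \<open>lo\<close>, because what lies below
  \<open>lo\<close> lies below the whole box. An upper bound on entry 0 is passed on to every entry,
  since entry 0 is a largest one.\<close>

fun covers :: "nat \<Rightarrow> nat list list \<Rightarrow> nat list \<Rightarrow> nat list \<Rightarrow> cover \<Rightarrow> bool" where
  "covers n ps lo hi Infeasible \<longleftrightarrow>
     sum_list hi < n \<or> n < sum_list lo \<or> \<not> list_all2 (\<le>) lo hi"
| "covers n ps lo hi (Leaf gs r i) \<longleftrightarrow>
     list_all2 (\<le>) (rotate i (if r then rev gs else gs)) lo \<and> gs \<in> set ps"
| "covers n ps lo hi (Split i t s s') \<longleftrightarrow>
     covers n ps lo (if i = 0 then map (min (t - 1)) hi else hi[i := t - 1]) s \<and>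
     covers n ps (lo[i := t]) hi s'"

lemma list_all2_le_trans:
  "list_all2 (\<le>) xs ys \<Longrightarrow> list_all2 (\<le>) ys zs \<Longrightarrow> list_all2 (\<le>) xs zs" for xs ys zs :: "nat list"
  by (rule list_all2_trans[of "(\<le>)" "(\<le>)"]) auto

text \<open>The sequence \<open>xs\<close> chooses its own branch at each split and stays inside the
  current box. It cannot end at \<open>Infeasible\<close>, where the box contains no sequence with
  sum \<open>n\<close>, and at a leaf it dominates \<open>lo\<close>.\<close>

lemma covers_sound:
  assumes "covers n ps lo hi s" "list_all2 (\<le>) lo xs" "list_all2 (\<le>) xs hi"
    and "sum_list xs = n" "\<forall>x \<in> set xs. x \<le> xs ! 0"
  shows "\<exists>gs \<in> set ps. \<exists>r i. list_all2 (\<le>) (rotate i (if r then rev gs else gs)) xs"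
  using assms
proof (induction s arbitrary: lo hi)
  case Infeasible
  have sum_le: "sum_list ys \<le> sum_list zs" if "list_all2 (\<le>) ys zs" for ys zs :: "nat list"
    using that by (induction rule: list_all2_induct) auto
  show ?case
    using Infeasible sum_le[of lo xs] sum_le[of xs hi] list_all2_le_trans[of lo xs hi] by auto
next
  case (Leaf gs r i)
  have "gs \<in> set ps" using Leaf.prems(1) by simp
  moreover have "list_all2 (\<le>) (rotate i (if r then rev gs else gs)) xs"
    using Leaf.prems(1,2) list_all2_le_trans unfolding covers.simps by blast
  ultimately show ?case by blast
next
  case (Split i t s s')
  show ?case
  proof (cases "xs ! i < t")
    case True
    have "list_all2 (\<le>) xs (if i = 0 then map (min (t - 1)) hi else hi[i := t - 1])"
    proof (cases "i = 0")
      case i: True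
      \<comment> \<open>The bound \<open>xs ! 0 < t\<close> makes \<open>t\<close> positive, so
        \<open>t - 1\<close> is a true predecessor; it limits every entry because
        \<open>xs ! 0\<close> is a largest one.\<close>
      have "x \<le> t - 1" if "x \<in> set xs" for x
        using that True Split.prems(5) i by fastforce
      then show ?thesis
        using Split.prems(3) i by (auto simp: list_all2_conv_all_nth)
    next
      case False
      \<comment> \<open>Writing \<open>xs\<close> as \<open>xs[i := xs ! i]\<close> makes both sides
        updates at \<open>i\<close>. This works for an index out of range too, so the trees need no
        range check.\<close>
      have "list_all2 (\<le>) (xs[i := xs ! i]) (hi[i := t - 1])"
        using Split.prems(3) True by (intro list_all2_update_cong) auto
      then show ?thesis using False by simp
    qed
    moreover have "covers n ps lo (if i = 0 then map (min (t - 1)) hi else hi[i := t - 1]) s"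
      using Split.prems(1) by simp
    ultimately show ?thesis using Split.IH(1) Split.prems(2,4,5) by blast
  next
    case False
    then have "list_all2 (\<le>) (lo[i := t]) (xs[i := xs ! i])"
      using Split.prems(2) by (intro list_all2_update_cong) auto
    moreover have "covers n ps (lo[i := t]) hi s'" using Split.prems(1) by simp
    ultimately show ?thesis using Split.IH(2) Split.prems(3-5) by simp
  qed
qed

lemma not_pageable:
  assumes "list_all certified cs" "list_all ((=) m \<circ> length \<circ> fst) cs" "0 < m"
    and "covers n (map fst cs) (replicate m 0) (replicate m n) s"
    and "count_list w True = m" "count_list w False = n"
  shows "\<not> pageable w (m - 1)"
proof
  assume w: "pageable w (m - 1)"
  obtain g gs where gs: "w = replicate g False @ gap_word gs" using gap_word_exists by blast
  then have len: "length gs = m"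
    using assms(5) by (simp add: count_list_gap_word count_list_replicate)
  then have "gs \<noteq> []" using assms(3) by auto
  then obtain hs h where hs: "gs = hs @ [h]" by (cases gs rule: rev_cases) auto
  \<comment> \<open>The \<open>g\<close> right vertices at the front move to the end, where they
    join the last gap \<open>h\<close>.\<close>
  have w2: "pageable (gap_word (hs @ [h + g])) (m - 1)"
    using pageable_append_swap w unfolding gs hs
    by (metis append.assoc append_Cons append_Nil append_Nil2 gap_word_simps replicate_add)
  define ks where "ks = hs @ [h + g]"
  have ks: "length ks = m" "sum_list ks = n" "ks \<noteq> []"
    using assms(6) len by (auto simp: ks_def gs hs count_list_gap_word count_list_replicate)
  \<comment> \<open>\<open>covers_sound\<close> expects a largest entry in front, so the sequence is
    rotated to begin with a maximum.\<close>
  define M where "M = Max (set ks)"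
  have "M \<in> set ks" using ks(3) by (simp add: M_def)
  then obtain us vs where uv: "ks = us @ M # vs" by (meson split_list)
  have "\<forall>x \<in> set ks. x \<le> M" by (simp add: M_def)
  define xs where "xs = M # vs @ us"
  have xs: "length xs = m" "sum_list xs = n" "\<forall>x \<in> set xs. x \<le> xs ! 0"
    using ks uv \<open>\<forall>x \<in> set ks. x \<le> M\<close> by (auto simp: xs_def)
  have w3: "pageable (gap_word xs) (m - 1)"
    using w2 pageable_gap_word_append_swap[of us "M # vs"] uv unfolding ks_def[symmetric] xs_def
    by simp
  have "list_all2 (\<le>) (replicate m 0) xs" using xs(1) by (simp add: list_all2_conv_all_nth)
  \<comment> \<open>No entry exceeds the sum \<open>n\<close>, so the initial box from 0 to
    \<open>n\<close> contains \<open>xs\<close>.\<close>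
  moreover have "list_all2 (\<le>) xs (replicate m n)"
    using xs(1,2) member_le_sum_list[of _ xs] by (auto simp: list_all2_conv_all_nth)
  ultimately obtain p r i where p: "p \<in> set (map fst cs)"
    "list_all2 (\<le>) (rotate i (if r then rev p else p)) xs"
    using covers_sound[OF assms(4) _ _ xs(2,3)] by blast
  have "pageable (gap_word p) (m - 1)"
    by (rule pageable_dihedral_image[OF pageable_subseq[OF subseq_gap_word[OF p(2)] w3]])
  moreover obtain es where "(p, es) \<in> set cs" using p(1) by auto
  \<comment> \<open>All sequences in the table have \<open>m\<close> entries, which identifies the
    \<open>length p - 1\<close> pages of the certificate with \<open>m - 1\<close>.\<close>
  then have "certified (p, es)" "length p = m"
    using assms(1,2) by (auto simp: list_all_iff simp del: certified.simps)
  ultimately show False using not_pageable_certified by blast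
qed

section \<open>Certificates\<close>

text \<open>The data were found by computer search. An edge is a pair of positions in the word of its gap
sequence. The order of the edges matters for the size of the backtracking search.\<close>

definition certificates_three :: "(nat list \<times> (nat \<times> nat) list) list" where
  "certificates_three = [
    ([1, 1, 1], [(0, 3), (2, 5), (1, 4)]),
    ([2, 1, 0], [(0, 2), (1, 3), (1, 5), (2, 5), (0, 4)]),
    ([3, 0, 0], [(0, 3), (1, 4), (2, 5)])]"

text \<open>Each of the five trees sends a first entry of at least m = k + 1 to the leaf
  \<open>[m, 0, ..., 0]\<close>. Its word is one left vertex, m right ones and m - 1 left ones, so
  the edges (i, i + m) for i < m cross pairwise and need m pages. All other branches concern gaps of
  size at most k.\<close>

definition cover_three :: cover where
  "cover_three =
    Split 0 3 (Split 0 2 (Split 0 1 Infeasible (Split 1 1 Infeasible (Split 2 1 Infeasible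
    (Leaf [1, 1, 1] False 0)))) (Split 1 1 (Split 2 1 Infeasible (Leaf [2, 1, 0] True 2))
    (Leaf [2, 1, 0] False 0))) (Leaf [3, 0, 0] False 0)"

text \<open>Up to rotation and reflection these sequences are all arrangements of K_{3,3}: the
  partitions of 3 are 1 + 1 + 1, 2 + 1 and 3, and the symmetries of a triangle permute its corners
  arbitrarily.\<close>

lemma certified_three: "list_all certified certificates_three"
  by code_simp

lemma length_certificates_three: "list_all ((=) 3 \<circ> length \<circ> fst) certificates_three"
  by code_simp

lemma covers_three:
  "covers 3 (map fst certificates_three) (replicate 3 0) (replicate 3 3) cover_three"
  by code_simp

section \<open>Three pages: K_{4,5}\<close>

definition certificates_four :: "(nat list \<times> (nat \<times> nat) list) list" where
  "certificates_four = [
    ([2, 1, 0, 1], [(0, 4), (3, 7), (1, 5), (2, 6)]),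
    ([2, 1, 1, 0], [(0, 4), (3, 6), (1, 5), (2, 5), (2, 7), (4, 7), (1, 3), (0, 6), (0, 2),
      (1, 7)]),
    ([3, 0, 2, 0], [(0, 3), (1, 4), (2, 5), (2, 8), (3, 8), (1, 5), (0, 6), (0, 7), (4, 6),
      (4, 7), (5, 7), (6, 8)]),
    ([3, 1, 0, 0], [(0, 3), (1, 4), (2, 6), (2, 7), (3, 7), (1, 6), (0, 5)]),
    ([4, 0, 0, 0], [(0, 4), (1, 5), (2, 6), (3, 7)])]"

definition cover_four :: cover where
  "cover_four =
    Split 0 4 (Split 1 1 (Split 3 1 (Split 0 3 Infeasible (Split 2 2 Infeasible
    (Leaf [3, 0, 2, 0] False 0))) (Split 2 1 (Split 0 3 Infeasible (Leaf [3, 1, 0, 0] True 3))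
    (Split 0 2 Infeasible (Leaf [2, 1, 1, 0] True 3)))) (Split 2 1 (Split 3 1 (Split 0 3
    Infeasible (Leaf [3, 1, 0, 0] False 0)) (Split 0 2 Infeasible (Leaf [2, 1, 0, 1] False 0)))
    (Split 0 2 Infeasible (Leaf [2, 1, 1, 0] False 0)))) (Leaf [4, 0, 0, 0] False 0)"

text \<open>The shortest lists, those with as many edges as the sequence has entries, consist of all
  diameters of the vertex circle, which here has k + 1 vertices of either side. Diameters cross
  pairwise, so these k + 1 edges need k + 1 pages. Such lists occur in all five tables.\<close>

lemma certified_four: "list_all certified certificates_four"
  by code_simp

lemma length_certificates_four: "list_all ((=) 4 \<circ> length \<circ> fst) certificates_four"
  by code_simp

lemma covers_four:
  "covers 5 (map fst certificates_four) (replicate 4 0) (replicate 4 5) cover_four"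
  by code_simp

section \<open>Four pages: K_{5,7}\<close>

definition certificates_five :: "(nat list \<times> (nat \<times> nat) list) list" where
  "certificates_five = [
    ([2, 1, 1, 0, 1], [(0, 4), (3, 9), (1, 5), (2, 7), (2, 8), (1, 7), (0, 6), (5, 9), (4, 8)]),
    ([2, 1, 1, 2, 0], [(0, 4), (3, 8), (1, 5), (2, 7), (4, 10), (0, 6), (1, 7), (2, 10),
      (5, 9), (6, 10), (0, 8), (1, 10), (0, 2), (1, 3), (2, 5), (4, 7), (3, 6)]),
    ([2, 2, 0, 1, 0], [(0, 5), (3, 8), (1, 6), (2, 7), (4, 9)]),
    ([3, 1, 0, 0, 1], [(0, 5), (4, 9), (1, 6), (2, 7), (3, 8)]),
    ([3, 1, 0, 3, 0], [(0, 5), (4, 10), (1, 6), (2, 7), (3, 7), (4, 8), (3, 11), (5, 11),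
      (2, 6), (1, 4), (0, 3), (2, 11), (0, 8), (0, 9), (6, 9), (7, 10), (8, 11)]),
    ([3, 1, 1, 1, 0], [(4, 9), (2, 6), (3, 8), (5, 10), (0, 7), (1, 8), (2, 10), (0, 3),
      (1, 4)]),
    ([3, 2, 1, 0, 0], [(0, 6), (4, 8), (2, 7), (5, 9), (5, 10), (6, 10), (3, 9), (0, 8),
      (1, 9), (1, 4), (2, 10), (0, 3)]),
    ([4, 0, 2, 1, 0], [(0, 4), (1, 5), (2, 9), (3, 11), (2, 6), (3, 9), (5, 10), (0, 8),
      (7, 11)]),
    ([4, 0, 3, 0, 0], [(0, 4), (1, 5), (2, 6), (3, 10), (3, 11), (4, 11), (2, 10), (0, 7),
      (0, 9), (7, 11), (8, 11), (5, 8), (6, 9), (7, 10)]),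
    ([4, 1, 0, 0, 0], [(0, 4), (1, 5), (2, 7), (3, 8), (3, 9), (4, 9), (2, 8), (0, 6), (1, 7)]),
    ([5, 0, 0, 0, 0], [(0, 5), (1, 6), (2, 7), (3, 8), (4, 9)]),
    ([3, 1, 3, 0, 0], [(0, 5), (1, 6), (2, 10), (3, 11), (4, 9), (2, 6), (5, 11), (0, 9),
      (1, 10), (2, 11), (1, 4), (0, 3), (5, 10), (7, 11)])]"

text \<open>If entry 0 is below 3, every entry is at most 2, and a sum of 7 over five entries leaves
  room for at most one zero. This is why a zero in entry 3 leads through a chain of
  \<open>Infeasible\<close> branches straight to the leaf \<open>[2, 1, 1, 0, 1]\<close>. The larger
  trees use the sum in the same way.\<close>

definition cover_five :: cover where
  "cover_five =
    Split 0 4 (Split 0 3 (Split 3 1 (Split 0 2 Infeasible (Split 1 1 Infeasible (Split 2 1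
    Infeasible (Split 4 1 Infeasible (Leaf [2, 1, 1, 0, 1] False 0))))) (Split 4 1 (Split 1 2
    (Split 0 1 Infeasible (Split 1 1 Infeasible (Split 2 2 Infeasible
    (Leaf [2, 1, 1, 0, 1] True 2)))) (Split 0 2 Infeasible (Leaf [2, 2, 0, 1, 0] False 0)))
    (Split 1 1 (Split 2 2 (Split 0 1 Infeasible (Split 2 1 Infeasible (Split 4 2 Infeasible
    (Leaf [2, 1, 1, 0, 1] True 0)))) (Split 0 2 Infeasible (Leaf [2, 1, 1, 2, 0] False 3)))
    (Split 0 2 Infeasible (Leaf [2, 1, 1, 0, 1] True 4))))) (Split 4 1 (Split 1 2 (Split 1 1
    (Split 2 3 (Split 2 2 (Split 2 1 Infeasible (Split 3 3 Infeasible
    (Leaf [3, 1, 0, 3, 0] True 1))) (Split 3 2 Infeasible (Leaf [2, 2, 0, 1, 0] False 3)))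
    (Split 3 1 Infeasible (Leaf [3, 1, 0, 3, 0] False 3))) (Split 3 1 (Split 2 3 Infeasible
    (Leaf [3, 1, 3, 0, 0] False 0)) (Split 2 1 (Split 3 3 Infeasible
    (Leaf [3, 1, 0, 3, 0] False 0)) (Leaf [3, 1, 1, 1, 0] False 0)))) (Split 2 1 (Split 3 1
    Infeasible (Leaf [2, 2, 0, 1, 0] False 0)) (Leaf [3, 2, 1, 0, 0] False 0))) (Split 1 1
    (Split 4 2 (Split 2 1 (Split 3 3 Infeasible (Leaf [3, 1, 3, 0, 0] False 2)) (Split 3 1
    (Split 2 3 Infeasible (Leaf [3, 1, 0, 3, 0] True 4)) (Leaf [3, 1, 1, 1, 0] True 4)))
    (Split 2 1 (Split 3 1 Infeasible (Leaf [3, 2, 1, 0, 0] True 4))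
    (Leaf [2, 2, 0, 1, 0] False 1))) (Leaf [3, 1, 0, 0, 1] False 0)))) (Split 0 5 (Split 4 1
    (Split 1 1 (Split 3 3 (Split 2 3 (Split 3 2 (Split 2 2 Infeasible (Split 3 1 Infeasible
    (Leaf [4, 0, 2, 1, 0] False 0))) (Split 2 1 Infeasible (Leaf [4, 0, 2, 1, 0] True 4)))
    (Leaf [4, 0, 3, 0, 0] False 0)) (Leaf [4, 0, 3, 0, 0] True 4))
    (Leaf [4, 1, 0, 0, 0] False 0)) (Leaf [4, 1, 0, 0, 0] True 4))
    (Leaf [5, 0, 0, 0, 0] False 0))"

lemma certified_five: "list_all certified certificates_five"
  by code_simp

lemma length_certificates_five: "list_all ((=) 5 \<circ> length \<circ> fst) certificates_five"
  by code_simp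

lemma covers_five:
  "covers 7 (map fst certificates_five) (replicate 5 0) (replicate 5 7) cover_five"
  by code_simp

section \<open>Five pages: K_{6,10}\<close>

definition certificates_six :: "(nat list \<times> (nat \<times> nat) list) list" where
  "certificates_six = [
    ([2, 0, 2, 0, 2, 0], [(0, 6), (3, 9), (4, 10), (1, 7), (2, 8), (5, 11)]),
    ([2, 2, 0, 2, 1, 0], [(0, 5), (3, 11), (1, 6), (2, 10), (4, 12), (2, 7), (3, 8), (4, 10),
      (6, 11), (0, 9), (8, 12)]),
    ([2, 2, 1, 0, 1, 0], [(0, 7), (3, 10), (1, 8), (2, 9), (4, 11), (5, 11), (0, 5), (1, 6),
      (3, 7), (4, 8), (5, 9), (6, 10)]),
    ([3, 1, 1, 0, 0, 1], [(0, 5), (4, 11), (1, 6), (2, 8), (3, 9), (3, 10), (2, 9), (1, 8),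
      (0, 7), (6, 11), (5, 10)]),
    ([3, 2, 0, 0, 1, 0], [(0, 6), (4, 10), (1, 7), (2, 8), (3, 9), (5, 11)]),
    ([3, 2, 1, 2, 0, 0], [(4, 10), (2, 7), (3, 9), (5, 12), (6, 13), (0, 6), (0, 8), (5, 13),
      (1, 9), (2, 12), (3, 13), (1, 4), (0, 3), (2, 13), (1, 12), (0, 11), (10, 13), (7, 11),
      (8, 12)]),
    ([3, 2, 2, 1, 0, 0], [(0, 9), (4, 11), (3, 10), (5, 12), (6, 13), (2, 7), (1, 10), (0, 6),
      (5, 13), (2, 12), (3, 13), (1, 4), (0, 3), (2, 13), (1, 12), (0, 11), (9, 13), (8, 12),
      (7, 11), (4, 8), (5, 10)]),
    ([4, 1, 0, 0, 0, 1], [(0, 6), (5, 11), (1, 7), (2, 8), (3, 9), (4, 10)]),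
    ([4, 1, 0, 0, 4, 0], [(0, 6), (5, 12), (1, 7), (2, 8), (3, 9), (4, 9), (5, 10), (4, 14),
      (6, 14), (3, 8), (2, 7), (1, 5), (0, 4), (3, 14), (2, 9), (1, 8), (7, 11), (8, 12),
      (0, 11), (9, 13), (10, 14)]),
    ([4, 1, 0, 1, 2, 0], [(0, 6), (5, 11), (1, 7), (2, 8), (3, 10), (4, 10), (4, 13), (6, 13),
      (3, 8), (2, 7), (1, 5), (0, 4), (3, 13), (2, 10), (0, 9), (8, 12), (7, 11), (5, 9),
      (6, 10)]),
    ([4, 1, 0, 2, 1, 0], [(0, 6), (5, 12), (1, 7), (2, 8), (3, 11), (6, 13), (4, 11), (4, 13),
      (3, 8), (2, 7), (1, 5), (0, 4), (3, 13), (2, 11), (0, 10), (9, 13), (8, 12), (6, 11),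
      (5, 9)]),
    ([4, 1, 1, 0, 1, 0], [(5, 11), (2, 7), (3, 9), (4, 10), (6, 12), (0, 8), (1, 9), (2, 10),
      (3, 12), (0, 4), (1, 5)]),
    ([4, 2, 0, 3, 0, 0], [(0, 7), (5, 12), (1, 8), (2, 9), (6, 13), (6, 14), (5, 10), (3, 9),
      (7, 14), (3, 13), (2, 8), (4, 14), (1, 5), (0, 4), (3, 14), (2, 13), (0, 10), (0, 12),
      (10, 14), (11, 14), (8, 11), (9, 12), (10, 13)]),
    ([4, 2, 2, 0, 0, 0], [(0, 7), (1, 8), (2, 11), (3, 12), (4, 13), (6, 13), (4, 12), (3, 11),
      (2, 8), (1, 5), (0, 4), (3, 13), (2, 12), (1, 11), (0, 10), (9, 13), (7, 12), (5, 9),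
      (6, 11)]),
    ([5, 0, 1, 2, 1, 0], [(0, 5), (1, 6), (2, 7), (3, 9), (4, 12), (5, 14), (4, 14), (3, 12),
      (2, 9), (0, 8), (7, 13), (8, 14), (0, 11), (6, 10), (10, 14), (9, 13), (7, 11)]),
    ([5, 0, 2, 0, 1, 0], [(0, 5), (1, 6), (2, 7), (3, 11), (4, 13), (2, 10), (3, 10), (4, 11),
      (6, 12), (0, 9), (8, 13)]),
    ([5, 0, 2, 2, 0, 0], [(0, 5), (1, 6), (2, 7), (3, 10), (4, 13), (4, 14), (3, 13), (2, 10),
      (0, 9), (8, 14), (6, 11), (7, 12)]),
    ([5, 0, 4, 0, 0, 0], [(0, 5), (1, 6), (2, 7), (3, 12), (4, 13), (4, 14), (5, 14), (3, 13),
      (2, 12), (0, 11), (0, 9), (9, 14), (10, 14), (6, 10), (9, 13), (7, 11), (8, 12)]),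
    ([5, 1, 0, 0, 0, 0], [(0, 5), (1, 6), (2, 8), (3, 9), (4, 10), (4, 11), (5, 11), (3, 10),
      (0, 7), (2, 9), (1, 8)]),
    ([6, 0, 0, 0, 0, 0], [(0, 6), (1, 7), (2, 8), (3, 9), (4, 10), (5, 11)]),
    ([4, 1, 1, 4, 0, 0], [(0, 6), (1, 7), (2, 9), (3, 14), (4, 15), (0, 8), (1, 9), (6, 15),
      (5, 13), (3, 9), (2, 14), (2, 7), (3, 15), (0, 4), (1, 5), (5, 10), (7, 13), (8, 14),
      (0, 11), (10, 15)]),
    ([5, 0, 0, 5, 0, 0], [(0, 11), (7, 12), (8, 13), (9, 14), (10, 15), (6, 11), (6, 12),
      (0, 10), (9, 15), (7, 13), (3, 14), (4, 15), (3, 8), (2, 7), (0, 5), (1, 6)]),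
    ([5, 0, 1, 4, 0, 0], [(0, 5), (1, 6), (2, 7), (3, 14), (4, 15), (2, 9), (3, 9), (4, 14),
      (5, 15), (0, 8), (6, 12), (7, 13), (8, 14), (0, 13), (10, 15)])]"

definition cover_six :: cover where
  "cover_six =
    Split 0 6 (Split 0 4 (Split 5 2 (Split 1 2 (Split 4 2 (Split 2 3 (Split 1 1 (Split 2 2
    Infeasible (Split 3 3 Infeasible (Split 5 1 Infeasible (Leaf [3, 2, 0, 0, 1, 0] True 2))))
    (Split 5 1 (Split 2 1 Infeasible (Split 3 3 Infeasible (Split 4 1 Infeasible
    (Leaf [3, 1, 1, 0, 0, 1] True 2)))) (Split 0 3 Infeasible (Split 2 1 Infeasible
    (Leaf [3, 1, 1, 0, 0, 1] False 0))))) (Split 3 2 (Split 1 1 Infeasible (Split 0 3 Infeasible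
    (Split 5 1 Infeasible (Leaf [3, 1, 1, 0, 0, 1] False 0)))) (Split 0 1 Infeasible
    (Leaf [3, 2, 0, 0, 1, 0] False 4)))) (Split 2 2 (Split 4 3 (Split 2 1 (Split 1 1 Infeasible
    (Split 3 3 Infeasible (Leaf [3, 2, 0, 0, 1, 0] False 3))) (Split 0 1 Infeasible (Split 3 2
    Infeasible (Leaf [2, 2, 1, 0, 1, 0] True 1)))) (Split 3 2 (Split 2 1 Infeasible (Split 3 1
    Infeasible (Split 5 1 Infeasible (Leaf [3, 1, 1, 0, 0, 1] True 1)))) (Split 0 1 Infeasible
    (Leaf [3, 2, 0, 0, 1, 0] True 1)))) (Split 0 2 Infeasible
    (Leaf [2, 0, 2, 0, 2, 0] False 0)))) (Split 4 1 (Split 3 2 (Split 3 1 (Split 0 3 Infeasible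
    (Split 2 3 Infeasible (Split 5 1 Infeasible (Leaf [3, 1, 1, 0, 0, 1] False 0)))) (Split 0 3
    Infeasible (Split 2 2 Infeasible (Leaf [3, 2, 2, 1, 0, 0] False 0)))) (Split 2 1 (Split 0 2
    Infeasible (Split 1 3 Infeasible (Leaf [3, 2, 0, 0, 1, 0] True 4))) (Split 0 3 Infeasible
    (Leaf [3, 2, 1, 2, 0, 0] False 0)))) (Split 0 3 (Split 0 2 Infeasible (Split 2 1 Infeasible
    (Leaf [2, 2, 1, 0, 1, 0] False 0))) (Leaf [3, 2, 0, 0, 1, 0] False 0)))) (Split 2 1
    (Split 3 1 (Split 0 3 Infeasible (Split 1 1 Infeasible (Split 4 1 Infeasible
    (Leaf [3, 1, 1, 0, 0, 1] True 5)))) (Split 1 1 (Split 4 2 (Split 0 2 Infeasible (Split 5 3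
    Infeasible (Leaf [3, 2, 0, 0, 1, 0] False 1))) (Split 0 3 Infeasible
    (Leaf [3, 2, 2, 1, 0, 0] True 5))) (Split 0 2 Infeasible (Leaf [2, 2, 1, 0, 1, 0] False 1))))
    (Split 0 3 (Split 4 1 (Split 0 2 Infeasible (Split 3 2 Infeasible
    (Leaf [2, 2, 0, 2, 1, 0] True 5))) (Split 0 2 Infeasible (Leaf [2, 2, 1, 0, 1, 0] True 5)))
    (Leaf [3, 2, 0, 0, 1, 0] True 5)))) (Split 1 1 (Split 0 5 (Split 5 2 (Split 4 2 (Split 2 3
    (Split 5 1 (Split 3 4 (Split 2 2 Infeasible (Split 3 2 Infeasible (Split 4 1 Infeasible
    (Leaf [2, 2, 1, 0, 1, 0] False 4)))) (Split 2 2 (Split 2 1 Infeasible (Split 4 1 Infeasible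
    (Leaf [4, 1, 0, 0, 0, 1] False 3))) (Leaf [4, 2, 0, 3, 0, 0] True 2))) (Split 2 1 (Split 3 4
    Infeasible (Split 4 1 Infeasible (Leaf [4, 1, 1, 4, 0, 0] False 3))) (Split 3 2 Infeasible
    (Leaf [4, 1, 0, 2, 1, 0] True 5)))) (Split 3 2 (Split 5 1 (Split 2 4 Infeasible (Split 3 1
    Infeasible (Leaf [4, 1, 0, 0, 4, 0] False 4))) (Split 2 4 (Split 3 1 Infeasible
    (Leaf [4, 1, 0, 1, 2, 0] True 5)) (Leaf [4, 1, 0, 0, 4, 0] True 5)))
    (Leaf [3, 2, 0, 0, 1, 0] False 4))) (Split 2 2 (Split 4 3 (Split 2 1 (Split 3 4 (Split 3 3
    Infeasible (Split 5 1 Infeasible (Leaf [3, 2, 1, 2, 0, 0] False 3)))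
    (Leaf [4, 2, 0, 3, 0, 0] False 3)) (Split 3 2 Infeasible (Leaf [2, 2, 1, 0, 1, 0] True 1)))
    (Split 3 2 (Split 3 1 (Split 2 1 Infeasible (Split 5 1 Infeasible
    (Leaf [4, 1, 1, 0, 1, 0] True 5))) (Split 5 1 (Split 4 4 Infeasible
    (Leaf [4, 1, 0, 0, 4, 0] True 1)) (Leaf [3, 1, 1, 0, 0, 1] False 2)))
    (Leaf [3, 2, 0, 0, 1, 0] True 1))) (Leaf [2, 0, 2, 0, 2, 0] False 0))) (Split 2 1 (Split 4 2
    (Split 5 3 (Split 3 3 Infeasible (Leaf [4, 2, 0, 3, 0, 0] True 5)) (Split 3 1 Infeasible
    (Leaf [3, 2, 0, 0, 1, 0] False 1))) (Leaf [4, 2, 2, 0, 0, 0] True 5))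
    (Leaf [3, 2, 0, 0, 1, 0] True 5))) (Split 5 1 (Split 4 2 (Split 2 4 (Split 2 2 (Split 3 5
    (Split 3 4 (Split 2 1 Infeasible (Split 3 2 Infeasible (Split 4 1 Infeasible
    (Leaf [5, 0, 1, 2, 1, 0] False 0)))) (Split 4 1 (Split 2 1 Infeasible
    (Leaf [5, 0, 1, 4, 0, 0] False 0)) (Leaf [5, 0, 1, 4, 0, 0] True 5)))
    (Leaf [5, 0, 0, 5, 0, 0] False 0)) (Split 3 2 (Split 4 1 Infeasible
    (Leaf [5, 0, 2, 0, 1, 0] False 0)) (Leaf [5, 0, 2, 2, 0, 0] False 0)))
    (Leaf [5, 0, 4, 0, 0, 0] False 0)) (Split 2 1 (Split 4 4 (Split 3 2 Infeasible
    (Leaf [5, 0, 2, 2, 0, 0] True 5)) (Leaf [5, 0, 4, 0, 0, 0] True 5))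
    (Leaf [5, 0, 2, 0, 1, 0] True 5))) (Leaf [5, 1, 0, 0, 0, 0] True 5))) (Split 5 1 (Split 0 5
    (Split 4 1 (Split 2 2 (Split 1 3 (Split 1 2 (Split 2 1 Infeasible (Split 3 4 Infeasible
    (Leaf [4, 1, 1, 4, 0, 0] False 0))) (Split 3 3 Infeasible (Leaf [4, 2, 0, 3, 0, 0] False 0)))
    (Split 3 1 Infeasible (Leaf [3, 2, 0, 0, 1, 0] True 4))) (Split 1 2 (Split 2 3 (Split 3 3
    Infeasible (Leaf [3, 2, 1, 2, 0, 0] True 2)) (Split 3 1 Infeasible
    (Leaf [3, 1, 1, 0, 0, 1] True 3))) (Leaf [4, 2, 2, 0, 0, 0] False 0))) (Split 2 1 (Split 1 2
    (Split 3 2 (Split 4 4 Infeasible (Leaf [4, 1, 0, 0, 4, 0] False 0))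
    (Leaf [4, 1, 0, 2, 1, 0] False 0)) (Leaf [3, 2, 0, 0, 1, 0] False 0))
    (Leaf [4, 1, 1, 0, 1, 0] False 0))) (Leaf [5, 1, 0, 0, 0, 0] False 0))
    (Leaf [4, 1, 0, 0, 0, 1] False 0)))) (Leaf [6, 0, 0, 0, 0, 0] False 0)"

lemma certified_six: "list_all certified certificates_six"
  by code_simp

lemma length_certificates_six: "list_all ((=) 6 \<circ> length \<circ> fst) certificates_six"
  by code_simp

lemma covers_six:
  "covers 10 (map fst certificates_six) (replicate 6 0) (replicate 6 10) cover_six"
  by code_simp

section \<open>Six pages: K_{7,13}\<close>

definition certificates_seven :: "(nat list \<times> (nat \<times> nat) list) list" where
  "certificates_seven = [
    ([2, 1, 1, 1, 0, 1, 1], [(0, 6), (3, 11), (5, 13), (1, 7), (2, 9), (4, 12), (2, 10),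
      (1, 9), (0, 8), (7, 13), (6, 12), (5, 11), (4, 10)]),
    ([2, 1, 2, 0, 1, 1, 0], [(0, 7), (3, 10), (5, 12), (1, 8), (2, 9), (4, 11), (6, 13)]),
    ([2, 2, 0, 2, 0, 2, 0], [(3, 9), (6, 12), (7, 13), (4, 10), (5, 11), (8, 14), (0, 9),
      (1, 10), (2, 11), (3, 12), (4, 14), (1, 7), (0, 5)]),
    ([2, 2, 1, 0, 1, 0, 1], [(0, 7), (3, 10), (6, 13), (1, 8), (2, 9), (4, 11), (5, 12)]),
    ([3, 0, 2, 0, 0, 2, 0], [(0, 7), (4, 11), (5, 12), (1, 8), (2, 9), (3, 10), (6, 13)]),
    ([3, 1, 1, 0, 0, 1, 1], [(0, 7), (4, 11), (6, 13), (1, 8), (2, 9), (3, 10), (5, 12)]),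
    ([3, 2, 0, 0, 1, 1, 1], [(0, 6), (4, 10), (1, 7), (2, 8), (3, 9), (5, 11), (5, 13),
      (6, 13), (4, 12), (7, 14), (3, 11), (1, 8), (2, 9)]),
    ([3, 2, 0, 0, 1, 3, 0], [(0, 6), (4, 12), (1, 7), (2, 8), (3, 11), (5, 15), (2, 9), (3, 9),
      (4, 10), (5, 11), (7, 12), (8, 13), (0, 10), (9, 14)]),
    ([3, 2, 0, 0, 2, 2, 0], [(0, 6), (4, 13), (1, 7), (2, 8), (3, 12), (5, 15), (2, 9), (3, 9),
      (4, 10), (5, 12), (7, 13), (8, 14), (0, 11), (10, 15)]),
    ([3, 2, 0, 1, 0, 0, 2], [(0, 9), (7, 13), (8, 14), (3, 10), (5, 11), (6, 12), (1, 10),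
      (2, 11), (3, 12), (4, 13), (2, 8), (0, 5), (1, 7)]),
    ([3, 2, 0, 1, 1, 0, 1], [(0, 6), (4, 11), (1, 7), (2, 8), (3, 10), (5, 12), (6, 13),
      (7, 14), (0, 9), (1, 10), (2, 12), (4, 14), (3, 13)]),
    ([3, 2, 0, 2, 1, 1, 0], [(0, 6), (4, 14), (1, 7), (2, 8), (3, 13), (5, 15), (2, 11),
      (3, 11), (4, 12), (5, 13), (7, 14), (0, 10), (9, 15)]),
    ([3, 2, 1, 0, 1, 1, 0], [(0, 6), (4, 11), (1, 7), (2, 9), (3, 10), (5, 12), (5, 14),
      (6, 14), (4, 13), (0, 8), (3, 12), (1, 9), (2, 10)]),
    ([3, 2, 2, 0, 0, 1, 0], [(0, 9), (4, 13), (1, 10), (2, 11), (3, 12), (8, 14), (5, 14),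
      (7, 13), (0, 6), (5, 12), (1, 7), (3, 11), (2, 10)]),
    ([3, 3, 0, 0, 1, 0, 0], [(0, 7), (4, 11), (1, 8), (2, 9), (3, 10), (5, 12), (6, 13)]),
    ([3, 3, 0, 2, 0, 1, 0], [(0, 7), (4, 14), (1, 8), (2, 9), (3, 12), (6, 15), (3, 13),
      (5, 13), (2, 12), (4, 10), (5, 12), (6, 13), (8, 14), (0, 11), (10, 15)]),
    ([3, 3, 1, 0, 0, 1, 0], [(0, 7), (4, 13), (1, 8), (2, 10), (3, 11), (6, 14), (3, 12),
      (5, 12), (2, 11), (1, 10), (0, 9), (8, 13), (7, 12), (6, 11), (4, 9), (5, 10)]),
    ([4, 1, 1, 0, 0, 0, 1], [(0, 6), (5, 13), (1, 7), (2, 9), (3, 10), (4, 11), (4, 12),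
      (3, 11), (2, 10), (1, 9), (0, 8), (7, 13), (6, 12)]),
    ([4, 2, 0, 0, 0, 1, 0], [(0, 7), (5, 12), (1, 8), (2, 9), (3, 10), (4, 11), (6, 13)]),
    ([4, 2, 0, 0, 1, 0, 1], [(5, 11), (8, 14), (1, 9), (2, 10), (6, 12), (7, 13), (3, 10),
      (2, 9), (1, 8), (0, 7), (3, 12), (5, 14), (4, 13)]),
    ([4, 2, 0, 4, 0, 0, 1], [(0, 7), (5, 17), (1, 8), (2, 9), (3, 14), (4, 16), (4, 15),
      (6, 16), (3, 15), (2, 14), (1, 9), (8, 17), (0, 10), (7, 16), (6, 15), (9, 17), (5, 13),
      (6, 14), (7, 15), (0, 13), (5, 11), (12, 16), (11, 15), (8, 12), (10, 14), (9, 13)]),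
    ([4, 2, 1, 1, 2, 0, 0], [(5, 13), (2, 8), (3, 10), (4, 12), (6, 15), (7, 16), (0, 7),
      (0, 9), (6, 16), (1, 10), (2, 12), (3, 15), (4, 16), (1, 5), (0, 4), (3, 16), (2, 15),
      (1, 12), (0, 11), (9, 16), (8, 14), (9, 15), (11, 16), (0, 14), (13, 16), (11, 15),
      (10, 14), (8, 13), (5, 11), (6, 12)]),
    ([4, 2, 1, 2, 1, 0, 0], [(5, 14), (2, 8), (3, 10), (4, 13), (6, 15), (7, 16), (0, 7),
      (0, 9), (6, 16), (1, 10), (2, 13), (3, 15), (4, 16), (1, 5), (0, 4), (3, 16), (2, 15),
      (1, 13), (0, 12), (11, 16), (9, 15), (8, 14), (5, 11), (6, 13)]),
    ([4, 2, 2, 0, 3, 0, 0], [(5, 15), (2, 8), (3, 11), (4, 12), (6, 16), (7, 17), (0, 7),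
      (0, 10), (5, 13), (6, 17), (1, 11), (9, 17), (2, 12), (8, 14), (3, 16), (9, 16), (4, 17),
      (10, 17), (1, 5), (0, 4), (3, 17), (2, 16), (0, 13), (0, 15), (13, 17), (14, 17), (11, 15),
      (13, 16), (12, 15), (11, 14), (8, 13), (7, 12), (5, 9), (6, 11)]),
    ([4, 3, 1, 3, 0, 0, 0], [(0, 10), (3, 11), (6, 15), (7, 16), (8, 17), (5, 12), (2, 9),
      (1, 11), (0, 8), (7, 17), (6, 16), (2, 15), (3, 16), (4, 17), (1, 5), (0, 4), (3, 17),
      (2, 16), (1, 15), (0, 14), (10, 17), (13, 17), (12, 16), (9, 13), (10, 15)]),
    ([4, 3, 2, 2, 0, 0, 0], [(0, 11), (5, 13), (3, 12), (6, 15), (7, 16), (8, 17), (2, 9),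
      (1, 12), (0, 8), (7, 17), (6, 16), (2, 15), (3, 16), (4, 17), (1, 5), (0, 4), (3, 17),
      (2, 16), (1, 15), (0, 14), (13, 17), (11, 16), (9, 14), (10, 15)]),
    ([5, 1, 0, 0, 0, 0, 1], [(0, 7), (6, 13), (1, 8), (2, 9), (3, 10), (4, 11), (5, 12)]),
    ([5, 1, 0, 0, 0, 5, 0], [(0, 7), (6, 14), (1, 8), (2, 9), (3, 10), (4, 11), (5, 11),
      (6, 12), (5, 17), (7, 17), (4, 10), (3, 9), (2, 8), (1, 6), (0, 5), (4, 17), (3, 11),
      (2, 10), (1, 9), (8, 13), (9, 14), (10, 15), (0, 13), (11, 16), (12, 17)]),
    ([5, 1, 0, 0, 1, 3, 0], [(0, 7), (6, 13), (1, 8), (2, 9), (3, 10), (4, 12), (5, 12),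
      (5, 16), (4, 10), (3, 9), (2, 8), (1, 6), (0, 5), (4, 16), (3, 12), (2, 10), (1, 9),
      (8, 14), (9, 15), (0, 11), (10, 15), (9, 14), (8, 13), (6, 11), (7, 12)]),
    ([5, 1, 0, 1, 0, 3, 0], [(0, 7), (6, 13), (1, 8), (2, 9), (3, 11), (4, 12), (5, 12),
      (5, 16), (4, 11), (3, 9), (2, 8), (1, 6), (0, 5), (4, 16), (3, 12), (2, 11), (0, 10),
      (8, 14), (9, 15)]),
    ([5, 1, 0, 1, 1, 2, 0], [(0, 7), (6, 14), (1, 8), (2, 9), (3, 11), (4, 13), (5, 13),
      (5, 16), (7, 16), (4, 11), (3, 9), (2, 8), (1, 6), (0, 5), (4, 16), (3, 13), (2, 11),
      (0, 10), (9, 15), (8, 14), (6, 12), (7, 13)]),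
    ([5, 1, 0, 2, 0, 2, 0], [(0, 7), (6, 14), (1, 8), (2, 9), (3, 12), (4, 13), (5, 13),
      (5, 16), (4, 12), (3, 9), (2, 8), (1, 6), (0, 5), (4, 16), (3, 13), (2, 12), (0, 11),
      (8, 15), (10, 16)]),
    ([5, 1, 0, 4, 0, 1, 0], [(0, 7), (1, 8), (2, 9), (3, 14), (4, 15), (5, 17), (6, 16),
      (7, 17), (5, 15), (4, 14), (3, 9), (2, 8), (1, 6), (0, 5), (4, 17), (3, 15), (2, 14),
      (0, 11), (10, 17), (0, 13), (9, 16), (7, 15), (12, 17), (6, 11), (11, 15), (8, 12),
      (9, 13), (10, 14)]),
    ([5, 1, 1, 0, 0, 1, 0], [(6, 13), (2, 8), (3, 10), (4, 11), (5, 12), (7, 14), (0, 9),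
      (1, 10), (2, 11), (3, 12), (4, 14), (0, 5), (1, 6)]),
    ([5, 2, 0, 2, 2, 0, 0], [(0, 8), (6, 14), (1, 9), (2, 10), (3, 13), (7, 16), (7, 17),
      (4, 13), (8, 17), (4, 16), (3, 10), (5, 17), (2, 9), (1, 6), (0, 5), (4, 17), (3, 16),
      (2, 13), (0, 12), (11, 17), (10, 15), (9, 14), (6, 11), (7, 13)]),
    ([5, 2, 0, 3, 1, 0, 0], [(0, 8), (6, 15), (1, 9), (3, 10), (4, 14), (7, 17), (2, 10),
      (3, 14), (7, 16), (8, 17), (2, 9), (4, 16), (5, 17), (1, 6), (0, 5), (4, 17), (3, 16),
      (2, 14), (0, 13), (12, 17), (11, 16), (9, 15), (7, 14), (6, 11)]),
    ([5, 2, 1, 0, 1, 0, 0], [(6, 13), (3, 9), (4, 11), (5, 12), (7, 14), (8, 15), (0, 8),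
      (0, 10), (1, 11), (2, 12), (3, 14), (4, 15), (0, 5), (1, 6)]),
    ([5, 2, 1, 3, 0, 0, 0], [(0, 8), (1, 9), (2, 11), (3, 15), (4, 16), (5, 17), (7, 17),
      (5, 16), (4, 15), (3, 11), (2, 9), (1, 6), (0, 5), (4, 17), (3, 16), (2, 15), (1, 11),
      (0, 10), (8, 17), (7, 16), (6, 12), (7, 15), (8, 16), (10, 17), (0, 14), (13, 17),
      (12, 16), (9, 13), (10, 15)]),
    ([5, 2, 3, 0, 0, 0, 0], [(0, 8), (1, 9), (2, 13), (3, 14), (4, 15), (5, 16), (7, 16),
      (5, 15), (4, 14), (3, 13), (2, 9), (1, 6), (0, 5), (4, 16), (3, 15), (2, 14), (1, 13),
      (0, 12), (11, 16), (7, 15), (10, 15), (8, 14), (6, 10), (7, 13)]),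
    ([5, 3, 0, 4, 0, 0, 0], [(0, 9), (6, 13), (4, 10), (5, 11), (7, 16), (8, 18), (1, 10),
      (8, 17), (9, 18), (7, 17), (2, 11), (3, 16), (4, 17), (5, 18), (1, 6), (0, 5), (4, 18),
      (3, 17), (2, 16), (0, 13), (0, 15), (12, 18), (14, 18), (13, 17), (10, 14), (12, 16),
      (11, 15)]),
    ([6, 0, 1, 2, 0, 1, 0], [(0, 6), (1, 7), (2, 8), (3, 13), (4, 14), (5, 16), (2, 10),
      (3, 10), (1, 8), (4, 13), (5, 14), (7, 15), (9, 16), (0, 12), (11, 16), (10, 15), (9, 14),
      (7, 11), (8, 12)]),
    ([6, 0, 2, 0, 0, 1, 0], [(0, 6), (1, 7), (2, 8), (3, 12), (4, 13), (5, 15), (2, 11),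
      (3, 11), (4, 12), (5, 13), (7, 14), (0, 10), (9, 15)]),
    ([6, 0, 2, 0, 2, 0, 0], [(0, 6), (1, 7), (2, 8), (3, 11), (4, 12), (5, 15), (5, 16),
      (4, 15), (3, 12), (2, 11), (0, 10), (9, 16), (7, 13), (8, 14)]),
    ([6, 0, 3, 2, 0, 0, 0], [(0, 6), (1, 7), (2, 8), (3, 12), (4, 15), (5, 16), (5, 17),
      (6, 17), (4, 16), (3, 15), (2, 12), (0, 11), (10, 17), (9, 16), (7, 13), (8, 14)]),
    ([6, 1, 0, 0, 0, 0, 0], [(0, 6), (1, 7), (2, 9), (3, 10), (4, 11), (5, 12), (5, 13),
      (6, 13), (4, 12), (0, 8), (3, 11), (1, 9), (2, 10)]),
    ([7, 0, 0, 0, 0, 0, 0], [(0, 7), (1, 8), (2, 9), (3, 10), (4, 11), (5, 12), (6, 13)]),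
    ([5, 1, 1, 1, 5, 0, 0], [(0, 7), (1, 8), (2, 10), (3, 12), (4, 18), (5, 19), (6, 16),
      (7, 19), (4, 12), (0, 9), (1, 10), (2, 12), (3, 10), (2, 8), (3, 18), (1, 6), (0, 5),
      (4, 19), (6, 14), (8, 17), (9, 19), (0, 11), (8, 16), (10, 17), (11, 18), (13, 19),
      (0, 14)]),
    ([5, 1, 2, 0, 5, 0, 0], [(0, 10), (6, 13), (4, 12), (9, 19), (1, 11), (7, 18), (2, 12),
      (3, 11), (2, 8), (3, 18), (4, 19), (0, 5), (1, 6)]),
    ([5, 1, 2, 1, 4, 0, 0], [(0, 10), (6, 17), (1, 11), (5, 13), (7, 18), (9, 19), (2, 13),
      (3, 11), (3, 18), (2, 8), (4, 19), (0, 5), (1, 6)]),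
    ([5, 1, 2, 2, 3, 0, 0], [(0, 10), (6, 13), (8, 17), (7, 14), (9, 19), (4, 11), (9, 18),
      (10, 19), (8, 15), (5, 14), (6, 16), (7, 18), (6, 17), (0, 13), (12, 19), (11, 16),
      (12, 18), (13, 19), (0, 16), (15, 19), (14, 17), (15, 18), (16, 19), (0, 17), (1, 8),
      (4, 18), (5, 19), (0, 7)]),
    ([5, 2, 0, 1, 5, 0, 0], [(0, 8), (6, 14), (1, 9), (2, 10), (4, 12), (7, 19), (7, 18),
      (3, 12), (8, 19), (3, 10), (2, 9), (4, 18), (5, 19), (1, 6), (0, 5), (4, 19), (3, 18),
      (2, 12), (0, 11), (9, 16), (10, 17), (11, 18), (0, 14), (13, 19)]),
    ([6, 0, 0, 5, 2, 0, 0], [(0, 6), (1, 7), (2, 8), (3, 9), (4, 15), (5, 19), (4, 18),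
      (3, 15), (2, 9), (1, 8), (7, 16), (8, 17), (0, 13), (10, 18), (11, 19)]),
    ([6, 0, 1, 0, 6, 0, 0], [(7, 14), (8, 15), (10, 16), (11, 17), (12, 18), (13, 19), (0, 13),
      (12, 19), (0, 14), (7, 15), (8, 16), (9, 18), (4, 11), (0, 9), (3, 10), (2, 8), (6, 19),
      (4, 18), (1, 7), (0, 6), (5, 19)]),
    ([6, 0, 1, 1, 5, 0, 0], [(0, 6), (1, 7), (2, 8), (3, 10), (4, 12), (5, 18), (6, 19),
      (5, 19), (4, 18), (3, 12), (2, 10), (0, 9), (7, 15), (8, 16), (10, 17), (11, 18), (0, 15),
      (13, 19)]),
    ([6, 0, 1, 2, 4, 0, 0], [(0, 6), (1, 7), (2, 8), (3, 10), (4, 13), (5, 18), (6, 19),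
      (5, 19), (4, 18), (3, 13), (2, 10), (0, 9), (7, 15), (8, 17), (0, 12), (9, 18), (11, 19)]),
    ([6, 0, 2, 5, 0, 0, 0], [(0, 6), (2, 11), (3, 17), (4, 18), (5, 19), (1, 7), (2, 8),
      (3, 11), (4, 17), (5, 18), (6, 19), (0, 10), (9, 19), (8, 16), (7, 15), (9, 17), (0, 16),
      (10, 18), (12, 19)])]"

definition cover_seven :: cover where
  "cover_seven =
    Split 0 7 (Split 0 5 (Split 1 2 (Split 6 2 (Split 5 2 (Split 2 3 (Split 4 3 (Split 1 1
    (Split 3 4 (Split 0 1 Infeasible (Split 2 2 Infeasible (Split 3 3 Infeasible (Split 4 2
    Infeasible (Leaf [3, 2, 0, 1, 0, 0, 2] True 3))))) (Split 4 2 (Split 2 2 Infeasible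
    (Split 5 1 Infeasible (Leaf [4, 2, 0, 0, 0, 1, 0] True 3))) (Split 0 1 Infeasible (Split 2 1
    Infeasible (Leaf [4, 2, 0, 0, 1, 0, 1] False 4))))) (Split 6 1 (Split 3 4 (Split 2 1
    Infeasible (Split 0 1 Infeasible (Split 3 3 Infeasible (Split 4 2 Infeasible
    (Leaf [3, 2, 0, 0, 1, 1, 1] False 4))))) (Split 2 1 Infeasible (Split 4 1 Infeasible
    (Leaf [4, 1, 1, 0, 0, 0, 1] True 3)))) (Split 2 1 (Split 0 4 Infeasible (Split 5 1 Infeasible
    (Leaf [4, 1, 1, 0, 0, 0, 1] True 6))) (Split 0 4 (Split 0 3 Infeasible (Split 5 1 Infeasible
    (Leaf [3, 1, 1, 0, 0, 1, 1] False 0))) (Leaf [4, 1, 1, 0, 0, 0, 1] False 0))))) (Split 3 3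
    (Split 6 1 (Split 5 1 (Split 0 3 Infeasible (Split 2 2 Infeasible (Split 3 2 Infeasible
    (Split 4 4 Infeasible (Leaf [4, 2, 2, 0, 3, 0, 0] True 2))))) (Split 4 4 (Split 0 1
    Infeasible (Split 1 1 Infeasible (Split 3 2 Infeasible (Leaf [3, 2, 0, 1, 1, 0, 1] True 2))))
    (Split 2 1 Infeasible (Split 3 1 Infeasible (Leaf [4, 1, 1, 0, 0, 0, 1] True 2)))))
    (Split 2 2 (Split 4 4 (Split 0 1 Infeasible (Split 2 1 Infeasible (Split 3 2 Infeasible
    (Leaf [3, 2, 1, 0, 1, 1, 0] True 2)))) (Split 3 2 (Split 3 1 Infeasible (Split 5 1 Infeasible
    (Leaf [4, 1, 1, 0, 0, 0, 1] False 3))) (Leaf [4, 2, 0, 0, 0, 1, 0] True 2))) (Split 3 1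
    (Split 0 4 Infeasible (Split 1 1 Infeasible (Leaf [4, 1, 1, 0, 0, 0, 1] False 0))) (Split 0 1
    Infeasible (Leaf [2, 1, 2, 0, 1, 1, 0] False 5))))) (Split 0 1 Infeasible
    (Leaf [3, 3, 0, 0, 1, 0, 0] False 4)))) (Split 4 2 (Split 6 1 (Split 2 4 (Split 5 1
    (Split 1 1 Infeasible (Split 0 3 Infeasible (Split 3 4 Infeasible
    (Leaf [4, 3, 1, 3, 0, 0, 0] True 3)))) (Split 0 2 Infeasible (Split 3 3 Infeasible
    (Leaf [3, 3, 0, 2, 0, 1, 0] True 3)))) (Split 0 1 Infeasible (Split 3 2 Infeasible
    (Leaf [4, 2, 0, 0, 0, 1, 0] False 5)))) (Split 3 2 (Split 0 4 Infeasible (Split 1 1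
    Infeasible (Leaf [4, 1, 1, 0, 0, 0, 1] False 0))) (Split 0 3 Infeasible
    (Leaf [3, 2, 0, 0, 1, 3, 0] False 5)))) (Split 0 2 Infeasible
    (Leaf [3, 0, 2, 0, 0, 2, 0] False 5)))) (Split 2 2 (Split 3 2 (Split 5 4 (Split 1 1
    (Split 2 1 (Split 0 4 Infeasible (Split 3 1 Infeasible (Split 4 4 Infeasible
    (Leaf [4, 2, 0, 4, 0, 0, 1] False 3)))) (Split 4 4 (Split 4 3 Infeasible (Split 3 1
    Infeasible (Split 6 1 Infeasible (Leaf [3, 1, 1, 0, 0, 1, 1] False 3))))
    (Leaf [4, 2, 0, 0, 0, 1, 0] False 3))) (Split 5 3 (Split 6 1 (Split 3 1 Infeasible (Split 4 4
    Infeasible (Leaf [4, 2, 0, 0, 1, 0, 1] False 3))) (Split 0 4 Infeasible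
    (Leaf [4, 1, 1, 0, 0, 0, 1] True 6))) (Split 4 3 (Split 0 3 Infeasible (Split 4 2 Infeasible
    (Leaf [3, 2, 0, 0, 1, 3, 0] True 1))) (Leaf [3, 3, 0, 0, 1, 0, 0] False 3)))) (Split 4 2
    (Split 0 4 Infeasible (Split 1 1 Infeasible (Split 6 1 Infeasible
    (Leaf [4, 1, 1, 0, 0, 0, 1] True 6)))) (Split 0 1 Infeasible
    (Leaf [4, 2, 0, 0, 0, 1, 0] True 1)))) (Split 5 3 (Split 4 3 (Split 1 1 (Split 4 2 (Split 0 2
    Infeasible (Split 2 1 Infeasible (Split 6 1 Infeasible
    (Leaf [2, 1, 2, 0, 1, 1, 0] False 2)))) (Split 2 1 (Split 0 3 Infeasible (Split 3 4
    Infeasible (Leaf [4, 2, 2, 0, 3, 0, 0] False 4))) (Split 0 1 Infeasible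
    (Leaf [2, 2, 1, 0, 1, 0, 1] False 4)))) (Split 4 1 (Split 0 4 Infeasible (Split 6 1
    Infeasible (Leaf [4, 1, 1, 0, 0, 0, 1] True 6))) (Split 0 1 Infeasible
    (Leaf [2, 1, 2, 0, 1, 1, 0] False 4)))) (Split 0 1 Infeasible
    (Leaf [3, 2, 0, 1, 0, 0, 2] False 3))) (Split 0 2 Infeasible
    (Leaf [3, 0, 2, 0, 0, 2, 0] False 2)))) (Split 0 3 Infeasible
    (Leaf [3, 0, 2, 0, 0, 2, 0] False 0)))) (Split 0 4 (Split 5 2 (Split 6 3 (Split 2 2
    (Split 4 3 (Split 0 1 Infeasible (Split 2 1 Infeasible (Split 3 3 Infeasible (Split 4 2
    Infeasible (Leaf [3, 2, 0, 1, 1, 0, 1] False 4))))) (Split 0 2 Infeasible (Split 3 2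
    Infeasible (Leaf [3, 2, 0, 0, 2, 2, 0] True 2)))) (Split 4 2 (Split 0 3 Infeasible (Split 3 2
    Infeasible (Leaf [3, 2, 0, 0, 2, 2, 0] True 6))) (Split 0 2 Infeasible
    (Leaf [2, 2, 0, 2, 0, 2, 0] False 1)))) (Split 3 1 (Split 0 3 Infeasible (Split 2 2
    Infeasible (Split 4 2 Infeasible (Leaf [2, 2, 0, 2, 0, 2, 0] False 1)))) (Split 0 3
    Infeasible (Leaf [3, 3, 0, 0, 1, 0, 0] False 1)))) (Split 2 1 (Split 1 1 (Split 6 3
    (Split 5 3 (Split 0 1 Infeasible (Split 3 2 Infeasible (Split 4 3 Infeasible
    (Leaf [3, 2, 0, 0, 1, 1, 1] True 2)))) (Split 0 2 Infeasible (Split 3 1 Infeasible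
    (Leaf [3, 2, 2, 0, 0, 1, 0] False 2)))) (Split 0 3 Infeasible (Split 3 1 Infeasible
    (Leaf [3, 2, 0, 1, 0, 0, 2] True 0)))) (Split 3 1 (Split 4 2 Infeasible (Split 6 3 Infeasible
    (Leaf [3, 2, 2, 0, 0, 1, 0] True 0))) (Split 0 2 Infeasible
    (Leaf [2, 2, 1, 0, 1, 0, 1] False 1)))) (Split 0 3 (Split 1 1 Infeasible (Split 4 2
    Infeasible (Leaf [2, 1, 2, 0, 1, 1, 0] False 3))) (Leaf [3, 2, 2, 0, 0, 1, 0] True 6))))
    (Split 2 1 (Split 6 3 (Split 1 1 (Split 4 2 (Split 5 3 (Split 3 3 Infeasible (Split 5 2
    Infeasible (Leaf [4, 2, 2, 0, 3, 0, 0] True 6))) (Split 3 2 Infeasible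
    (Leaf [3, 0, 2, 0, 0, 2, 0] False 2))) (Split 5 1 (Split 3 3 Infeasible (Split 4 3 Infeasible
    (Leaf [3, 2, 0, 0, 2, 2, 0] True 2))) (Split 3 1 (Split 5 4 (Split 4 4 Infeasible (Split 5 3
    Infeasible (Leaf [4, 3, 1, 3, 0, 0, 0] False 3))) (Leaf [4, 1, 1, 0, 0, 0, 1] False 2))
    (Leaf [4, 2, 1, 2, 1, 0, 0] True 6)))) (Split 5 1 (Split 3 1 Infeasible
    (Leaf [4, 2, 0, 0, 1, 0, 1] True 6)) (Leaf [4, 1, 1, 0, 0, 0, 1] True 6))) (Split 3 1
    (Split 6 4 (Split 5 2 (Split 1 1 Infeasible (Split 5 1 Infeasible
    (Leaf [4, 1, 1, 0, 0, 0, 1] True 6))) (Split 4 2 (Split 1 1 Infeasible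
    (Leaf [4, 1, 1, 0, 0, 0, 1] True 6)) (Leaf [4, 3, 2, 2, 0, 0, 0] True 6))) (Split 4 1
    (Split 1 1 Infeasible (Split 5 1 Infeasible (Leaf [4, 1, 1, 0, 0, 0, 1] False 1)))
    (Leaf [4, 2, 0, 0, 0, 1, 0] False 1))) (Leaf [3, 3, 0, 0, 1, 0, 0] False 1)))
    (Leaf [4, 2, 0, 0, 0, 1, 0] True 6)))) (Split 0 4 (Split 6 2 (Split 1 3 (Split 4 1 (Split 2 2
    (Split 3 3 Infeasible (Split 5 2 Infeasible (Leaf [3, 0, 2, 0, 0, 2, 0] False 4))) (Split 0 3
    Infeasible (Split 5 1 Infeasible (Leaf [3, 2, 2, 0, 0, 1, 0] False 0)))) (Split 5 1
    (Split 6 1 (Split 2 3 (Split 0 1 Infeasible (Split 3 3 Infeasible (Split 4 3 Infeasible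
    (Leaf [3, 3, 0, 0, 1, 0, 0] False 4)))) (Split 0 2 Infeasible
    (Leaf [3, 2, 2, 0, 0, 1, 0] True 4))) (Split 0 3 Infeasible (Split 3 1 Infeasible
    (Leaf [3, 2, 0, 1, 1, 0, 1] False 0)))) (Split 2 1 (Split 3 2 (Split 0 3 Infeasible
    (Split 5 3 Infeasible (Leaf [3, 2, 0, 0, 1, 3, 0] False 0))) (Split 0 3 Infeasible
    (Leaf [3, 2, 0, 2, 1, 1, 0] False 0))) (Split 0 3 (Split 0 2 Infeasible (Split 3 2 Infeasible
    (Leaf [2, 1, 1, 1, 0, 1, 1] True 3))) (Leaf [3, 2, 1, 0, 1, 1, 0] False 0))))) (Split 4 1
    (Split 2 1 (Split 3 3 Infeasible (Split 5 2 Infeasible (Leaf [3, 0, 2, 0, 0, 2, 0] False 4)))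
    (Split 5 1 (Split 2 3 Infeasible (Split 3 3 Infeasible (Split 6 1 Infeasible
    (Leaf [3, 2, 0, 1, 0, 0, 2] True 4)))) (Split 0 3 Infeasible
    (Leaf [3, 3, 1, 0, 0, 1, 0] False 0)))) (Split 0 3 Infeasible
    (Leaf [3, 3, 0, 0, 1, 0, 0] False 0)))) (Split 3 1 (Split 4 1 (Split 0 3 Infeasible
    (Split 5 2 (Split 2 2 Infeasible (Split 5 1 Infeasible (Leaf [3, 1, 1, 0, 0, 1, 1] False 0)))
    (Split 2 1 Infeasible (Leaf [3, 1, 1, 0, 0, 1, 1] False 0)))) (Split 0 3 Infeasible
    (Leaf [3, 2, 0, 1, 0, 0, 2] True 6))) (Split 0 3 (Split 0 1 Infeasible (Split 4 1 Infeasible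
    (Leaf [2, 1, 2, 0, 1, 1, 0] False 1))) (Leaf [3, 2, 0, 1, 0, 0, 2] False 0)))) (Split 5 1
    (Split 4 1 (Split 2 1 (Split 6 2 (Split 3 4 Infeasible (Split 1 4 Infeasible
    (Leaf [4, 2, 0, 0, 0, 1, 0] True 5))) (Split 3 1 Infeasible
    (Leaf [3, 2, 0, 1, 0, 0, 2] False 0))) (Split 6 1 (Split 1 3 (Split 3 4 (Split 2 4 Infeasible
    (Split 3 2 Infeasible (Leaf [4, 1, 1, 0, 0, 0, 1] True 4))) (Split 2 3 Infeasible
    (Leaf [4, 3, 1, 3, 0, 0, 0] True 3))) (Split 3 3 (Split 1 4 (Split 2 4 Infeasible (Split 3 1
    Infeasible (Leaf [4, 1, 1, 0, 0, 0, 1] True 4))) (Split 3 1 Infeasible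
    (Leaf [4, 1, 1, 0, 0, 0, 1] False 6))) (Leaf [4, 3, 1, 3, 0, 0, 0] False 0)))
    (Leaf [4, 1, 1, 0, 0, 0, 1] False 0))) (Split 6 1 (Split 1 3 (Split 2 3 (Split 2 1 (Split 3 3
    Infeasible (Split 4 2 Infeasible (Leaf [3, 2, 0, 0, 2, 2, 0] False 4))) (Split 3 2 (Split 3 1
    Infeasible (Split 4 2 Infeasible (Leaf [4, 2, 1, 1, 2, 0, 0] False 0)))
    (Leaf [4, 2, 1, 2, 1, 0, 0] False 0))) (Leaf [3, 2, 2, 0, 0, 1, 0] True 4))
    (Leaf [3, 3, 0, 0, 1, 0, 0] False 0)) (Leaf [4, 2, 0, 0, 1, 0, 1] False 0)))
    (Leaf [4, 2, 0, 0, 0, 1, 0] False 0)))) (Split 6 1 (Split 0 6 (Split 1 2 (Split 2 2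
    (Split 5 3 (Split 4 3 (Split 1 1 (Split 2 1 (Split 3 5 (Split 3 4 Infeasible (Split 4 2
    Infeasible (Split 5 2 Infeasible (Leaf [4, 2, 2, 0, 3, 0, 0] False 4)))) (Split 4 2
    (Split 4 1 Infeasible (Split 5 2 Infeasible (Leaf [5, 1, 2, 0, 5, 0, 0] False 4))) (Split 5 1
    Infeasible (Leaf [5, 2, 1, 0, 1, 0, 0] False 4)))) (Split 3 4 (Split 3 2 Infeasible
    (Split 4 2 Infeasible (Split 5 1 Infeasible (Leaf [2, 2, 1, 0, 1, 0, 1] False 4))))
    (Split 5 1 (Split 4 2 Infeasible (Leaf [4, 2, 0, 0, 1, 0, 1] False 4)) (Split 4 1 (Split 3 5
    Infeasible (Leaf [5, 1, 0, 4, 0, 1, 0] True 3)) (Leaf [4, 1, 1, 0, 0, 0, 1] False 4)))))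
    (Split 3 4 (Split 5 2 (Split 2 1 Infeasible (Split 5 1 Infeasible
    (Leaf [5, 1, 1, 0, 0, 1, 0] False 0))) (Split 3 2 Infeasible
    (Leaf [5, 1, 0, 2, 0, 2, 0] False 0))) (Split 5 1 (Split 4 2 (Split 2 1 Infeasible (Split 4 1
    Infeasible (Leaf [4, 1, 1, 0, 0, 0, 1] True 3))) (Leaf [4, 2, 0, 0, 0, 1, 0] False 4))
    (Leaf [5, 1, 0, 4, 0, 1, 0] False 0)))) (Split 3 3 (Split 1 1 (Split 3 2 (Split 5 2
    (Split 2 1 Infeasible (Split 4 5 Infeasible (Split 5 1 Infeasible
    (Leaf [5, 1, 0, 4, 0, 1, 0] False 3)))) (Split 3 1 (Split 2 1 Infeasible (Split 4 4
    Infeasible (Leaf [4, 2, 0, 0, 0, 1, 0] False 3))) (Split 4 4 Infeasible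
    (Leaf [4, 2, 0, 4, 0, 0, 1] False 3)))) (Split 5 1 (Split 2 1 Infeasible (Split 4 5
    Infeasible (Leaf [5, 2, 1, 0, 1, 0, 0] True 2))) (Split 4 4 (Split 2 1 Infeasible
    (Leaf [2, 2, 1, 0, 1, 0, 1] False 4)) (Leaf [4, 2, 0, 0, 1, 0, 1] True 2)))) (Split 2 1
    (Split 3 2 (Split 3 1 (Split 4 5 Infeasible (Split 5 2 Infeasible
    (Leaf [5, 2, 0, 3, 1, 0, 0] False 3))) (Split 5 2 (Split 4 5 Infeasible (Split 5 1 Infeasible
    (Leaf [5, 1, 0, 0, 0, 0, 1] False 3))) (Leaf [3, 2, 0, 1, 1, 0, 1] False 3))) (Split 5 1
    (Split 4 5 Infeasible (Leaf [5, 2, 0, 1, 5, 0, 0] True 2))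
    (Leaf [3, 2, 0, 1, 1, 0, 1] True 2))) (Split 5 1 (Split 4 5 (Split 3 2 Infeasible (Split 4 4
    Infeasible (Leaf [4, 2, 1, 1, 2, 0, 0] True 2))) (Split 3 1 Infeasible
    (Leaf [5, 1, 1, 1, 5, 0, 0] False 0))) (Leaf [5, 1, 1, 0, 0, 1, 0] False 0))))
    (Leaf [3, 3, 0, 0, 1, 0, 0] False 4))) (Split 3 2 (Split 1 1 (Split 5 4 (Split 3 1 (Split 4 5
    (Split 2 1 Infeasible (Split 4 4 Infeasible (Leaf [3, 3, 0, 2, 0, 1, 0] False 3)))
    (Leaf [5, 3, 0, 4, 0, 0, 0] False 3)) (Split 4 3 Infeasible
    (Leaf [3, 3, 1, 0, 0, 1, 0] True 1))) (Split 4 2 (Split 4 1 Infeasible (Split 5 5 Infeasible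
    (Leaf [5, 1, 0, 0, 0, 5, 0] True 1))) (Leaf [4, 2, 0, 0, 0, 1, 0] True 1))) (Split 4 1
    (Split 3 1 Infeasible (Leaf [5, 1, 0, 1, 0, 3, 0] False 0))
    (Leaf [5, 1, 0, 0, 1, 3, 0] False 0))) (Leaf [3, 0, 2, 0, 0, 2, 0] False 2))) (Split 5 2
    (Split 4 2 (Split 2 4 (Split 5 1 (Split 4 1 (Split 3 5 (Split 1 1 Infeasible (Split 2 3
    Infeasible (Split 3 4 Infeasible (Leaf [4, 3, 1, 3, 0, 0, 0] True 3)))) (Split 1 1 (Split 2 3
    Infeasible (Leaf [5, 3, 0, 4, 0, 0, 0] True 3)) (Leaf [5, 2, 1, 3, 0, 0, 0] True 3)))
    (Split 3 4 (Split 2 3 Infeasible (Split 3 3 Infeasible (Leaf [3, 3, 1, 0, 0, 1, 0] False 5)))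
    (Leaf [4, 2, 0, 4, 0, 0, 1] True 3))) (Split 3 4 (Split 1 1 (Split 2 3 Infeasible (Split 3 3
    Infeasible (Leaf [3, 3, 0, 2, 0, 1, 0] True 3))) (Leaf [5, 1, 1, 0, 0, 1, 0] False 0))
    (Leaf [4, 2, 0, 0, 0, 1, 0] True 3))) (Split 3 2 (Split 2 5 (Split 1 1 Infeasible (Split 3 1
    Infeasible (Leaf [4, 1, 1, 0, 0, 0, 1] True 4))) (Split 3 1 (Split 1 1 Infeasible (Split 5 1
    Infeasible (Leaf [5, 1, 1, 0, 0, 1, 0] False 0))) (Leaf [5, 1, 0, 0, 0, 5, 0] False 5)))
    (Leaf [4, 2, 0, 0, 0, 1, 0] False 5))) (Split 2 3 (Split 3 3 (Split 1 1 (Split 4 5 (Split 3 2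
    (Split 3 1 Infeasible (Split 4 4 Infeasible (Split 5 1 Infeasible
    (Leaf [4, 1, 1, 0, 0, 0, 1] True 2)))) (Split 4 4 (Split 5 1 Infeasible
    (Leaf [2, 2, 1, 0, 1, 0, 1] False 4)) (Leaf [4, 2, 2, 0, 3, 0, 0] True 2))) (Split 3 1
    (Split 5 1 Infeasible (Leaf [5, 1, 0, 2, 0, 2, 0] False 3))
    (Leaf [5, 1, 2, 0, 5, 0, 0] True 2))) (Split 5 1 (Split 4 5 (Split 3 2 (Split 3 1 Infeasible
    (Split 4 4 Infeasible (Leaf [5, 1, 2, 1, 4, 0, 0] False 0))) (Split 4 3 Infeasible
    (Leaf [5, 1, 2, 2, 3, 0, 0] False 0))) (Leaf [5, 1, 2, 0, 5, 0, 0] False 0))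
    (Leaf [2, 1, 2, 0, 1, 1, 0] False 0))) (Leaf [3, 2, 0, 1, 0, 0, 2] True 3))
    (Leaf [3, 0, 2, 0, 0, 2, 0] False 5))) (Leaf [3, 0, 2, 0, 0, 2, 0] False 0))) (Split 5 1
    (Split 4 1 (Split 2 3 (Split 1 4 (Split 2 1 (Split 1 3 Infeasible (Split 3 4 Infeasible
    (Leaf [5, 3, 0, 4, 0, 0, 0] False 0))) (Split 3 3 Infeasible
    (Leaf [5, 2, 1, 3, 0, 0, 0] False 0))) (Split 3 1 Infeasible
    (Leaf [4, 2, 0, 0, 0, 1, 0] True 5))) (Leaf [5, 2, 3, 0, 0, 0, 0] False 0)) (Split 2 1
    (Split 1 3 (Split 3 3 (Split 3 2 (Split 3 1 Infeasible (Split 4 5 Infeasible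
    (Leaf [5, 2, 0, 1, 5, 0, 0] False 0))) (Split 4 2 Infeasible
    (Leaf [5, 2, 0, 2, 2, 0, 0] False 0))) (Leaf [5, 2, 0, 3, 1, 0, 0] False 0))
    (Leaf [3, 3, 0, 0, 1, 0, 0] False 0)) (Leaf [5, 2, 1, 0, 1, 0, 0] False 0)))
    (Leaf [4, 2, 0, 0, 0, 1, 0] False 0))) (Split 1 1 (Split 5 2 (Split 5 1 (Split 2 2 (Split 3 3
    (Split 3 2 (Split 4 6 (Split 2 1 Infeasible (Split 3 1 Infeasible (Split 4 5 Infeasible
    (Leaf [6, 0, 1, 1, 5, 0, 0] False 0)))) (Split 3 1 (Split 2 1 Infeasible
    (Leaf [6, 0, 1, 0, 6, 0, 0] False 0)) (Leaf [6, 1, 0, 0, 0, 0, 0] True 2))) (Split 4 5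
    (Split 2 1 Infeasible (Split 4 4 Infeasible (Leaf [6, 0, 1, 2, 4, 0, 0] False 0)))
    (Leaf [6, 0, 0, 5, 2, 0, 0] True 6))) (Split 4 3 (Split 4 2 (Split 3 6 (Split 2 1 Infeasible
    (Split 3 5 Infeasible (Split 4 1 Infeasible (Leaf [5, 1, 0, 0, 0, 0, 1] False 4))))
    (Split 4 1 (Split 2 1 Infeasible (Leaf [6, 1, 0, 0, 0, 0, 0] True 3))
    (Leaf [6, 1, 0, 0, 0, 0, 0] False 4))) (Split 3 5 (Split 2 1 Infeasible (Split 3 4 Infeasible
    (Leaf [4, 2, 0, 0, 1, 0, 1] False 4))) (Leaf [6, 0, 0, 5, 2, 0, 0] False 0)))
    (Leaf [3, 3, 0, 0, 1, 0, 0] False 4))) (Split 4 2 (Split 3 2 (Split 3 1 (Split 2 6 Infeasible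
    (Split 4 1 Infeasible (Leaf [6, 0, 2, 0, 0, 1, 0] True 4))) (Split 2 5 Infeasible
    (Leaf [5, 1, 0, 0, 0, 5, 0] False 5))) (Split 2 3 (Split 3 5 (Split 3 4 Infeasible (Split 4 1
    Infeasible (Leaf [4, 2, 0, 4, 0, 0, 1] True 3))) (Leaf [6, 0, 2, 5, 0, 0, 0] False 0))
    (Leaf [6, 0, 3, 2, 0, 0, 0] False 0))) (Leaf [6, 0, 2, 0, 2, 0, 0] False 0))) (Split 2 2
    (Split 2 1 (Split 3 6 (Split 4 6 (Split 3 4 (Split 4 5 (Split 4 4 (Split 3 3 Infeasible
    (Split 4 3 Infeasible (Leaf [3, 3, 0, 0, 1, 0, 0] False 4))) (Split 3 2 Infeasible
    (Leaf [4, 2, 0, 0, 1, 0, 1] True 2))) (Split 3 1 Infeasible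
    (Leaf [5, 1, 0, 0, 0, 0, 1] False 3))) (Split 4 2 (Split 3 5 Infeasible (Split 4 1 Infeasible
    (Leaf [6, 0, 1, 1, 5, 0, 0] True 6))) (Leaf [6, 0, 1, 2, 4, 0, 0] True 6)))
    (Leaf [6, 1, 0, 0, 0, 0, 0] False 3)) (Leaf [6, 0, 1, 0, 6, 0, 0] False 4)) (Split 3 2
    (Split 4 2 Infeasible (Leaf [6, 0, 1, 2, 0, 1, 0] True 6))
    (Leaf [6, 0, 1, 2, 0, 1, 0] False 0))) (Leaf [6, 0, 2, 0, 0, 1, 0] False 0))) (Split 2 1
    (Split 3 2 (Split 4 2 (Split 4 1 (Split 3 1 Infeasible (Split 5 6 Infeasible
    (Leaf [6, 0, 2, 0, 0, 1, 0] False 2))) (Split 5 5 Infeasible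
    (Leaf [5, 1, 0, 0, 0, 5, 0] True 1))) (Split 5 3 (Split 4 5 (Split 3 1 Infeasible (Split 4 4
    Infeasible (Leaf [4, 2, 0, 4, 0, 0, 1] False 3))) (Leaf [6, 0, 2, 5, 0, 0, 0] True 6))
    (Leaf [6, 0, 3, 2, 0, 0, 0] True 6))) (Leaf [6, 0, 2, 0, 2, 0, 0] True 6))
    (Leaf [6, 0, 2, 0, 0, 1, 0] True 6))) (Leaf [6, 1, 0, 0, 0, 0, 0] False 0))) (Split 1 1
    (Split 0 6 (Split 6 2 (Split 5 1 (Split 2 2 (Split 4 4 (Split 4 3 (Split 3 5 (Split 2 1
    Infeasible (Split 3 4 Infeasible (Split 4 2 Infeasible
    (Leaf [3, 2, 0, 1, 1, 0, 1] False 4)))) (Split 4 2 (Split 2 1 Infeasible (Split 4 1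
    Infeasible (Leaf [5, 1, 0, 0, 0, 0, 1] False 4))) (Leaf [5, 2, 0, 1, 5, 0, 0] False 4)))
    (Split 3 3 Infeasible (Leaf [3, 3, 0, 0, 1, 0, 0] False 4))) (Split 3 2 (Split 2 1 Infeasible
    (Leaf [5, 1, 0, 4, 0, 1, 0] True 6)) (Leaf [4, 2, 0, 0, 0, 1, 0] True 2))) (Split 4 2
    (Split 2 3 (Split 3 5 (Split 3 1 Infeasible (Split 4 1 Infeasible
    (Leaf [5, 1, 0, 1, 1, 2, 0] True 6))) (Leaf [5, 2, 0, 3, 1, 0, 0] True 3)) (Split 3 1
    Infeasible (Leaf [5, 1, 0, 0, 1, 3, 0] True 6))) (Leaf [5, 1, 0, 2, 0, 2, 0] True 6)))
    (Split 2 1 (Split 5 3 (Split 4 4 (Split 4 3 (Split 3 5 (Split 4 2 (Split 3 4 Infeasible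
    (Split 4 1 Infeasible (Split 5 2 Infeasible (Leaf [5, 1, 2, 1, 4, 0, 0] True 6)))) (Split 3 4
    (Split 3 3 Infeasible (Split 5 2 Infeasible (Leaf [5, 1, 2, 2, 3, 0, 0] True 6)))
    (Leaf [4, 2, 1, 1, 2, 0, 0] False 4))) (Split 4 1 (Split 5 2 Infeasible
    (Leaf [5, 1, 2, 0, 5, 0, 0] True 6)) (Leaf [5, 1, 1, 1, 5, 0, 0] False 4))) (Split 3 2
    Infeasible (Leaf [3, 2, 0, 0, 1, 1, 1] True 2))) (Split 3 1 (Split 4 5 Infeasible (Split 5 2
    Infeasible (Leaf [5, 2, 1, 3, 0, 0, 0] False 3))) (Leaf [4, 1, 1, 0, 0, 0, 1] False 3)))
    (Split 3 2 (Split 5 4 (Split 4 4 (Split 3 1 Infeasible (Split 4 1 Infeasible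
    (Leaf [3, 1, 1, 0, 0, 1, 1] False 2))) (Leaf [4, 3, 1, 3, 0, 0, 0] False 3)) (Split 4 1
    Infeasible (Leaf [4, 1, 1, 0, 0, 0, 1] False 2))) (Leaf [3, 0, 2, 0, 0, 2, 0] False 2)))
    (Leaf [5, 1, 1, 0, 0, 1, 0] True 6))) (Split 2 1 (Split 5 1 (Split 6 3 (Split 4 2 (Split 3 5
    Infeasible (Split 4 1 Infeasible (Leaf [5, 2, 0, 1, 5, 0, 0] True 6))) (Split 3 2 (Split 3 1
    Infeasible (Split 4 3 Infeasible (Leaf [5, 2, 0, 3, 1, 0, 0] True 6)))
    (Leaf [5, 2, 0, 2, 2, 0, 0] True 6))) (Split 3 1 (Split 4 4 (Split 4 1 Infeasible (Split 6 4
    Infeasible (Leaf [4, 2, 0, 0, 0, 1, 0] False 1))) (Leaf [5, 3, 0, 4, 0, 0, 0] True 6))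
    (Leaf [3, 3, 0, 0, 1, 0, 0] False 1))) (Split 3 1 (Split 5 3 (Split 4 3 (Split 4 1 Infeasible
    (Split 6 4 Infeasible (Leaf [4, 1, 1, 0, 0, 0, 1] True 0)))
    (Leaf [5, 2, 1, 3, 0, 0, 0] True 6)) (Leaf [5, 2, 3, 0, 0, 0, 0] True 6))
    (Leaf [5, 2, 1, 0, 1, 0, 0] True 6))) (Leaf [4, 2, 0, 0, 0, 1, 0] True 6)))
    (Leaf [6, 1, 0, 0, 0, 0, 0] True 6)) (Leaf [5, 1, 0, 0, 0, 0, 1] False 0))))
    (Leaf [7, 0, 0, 0, 0, 0, 0] False 0)"

text \<open>All but the last ten sequences have sum below 13: they refute an arrangement of a
  smaller K_{7,n} and with it every arrangement of K_{7,13} that contains it. The last ten have sum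
  13, and each excludes only its own arrangement, up to symmetry.\<close>

lemma certified_seven: "list_all certified certificates_seven"
  by code_simp

lemma length_certificates_seven: "list_all ((=) 7 \<circ> length \<circ> fst) certificates_seven"
  by code_simp

lemma covers_seven:
  "covers 13 (map fst certificates_seven) (replicate 7 0) (replicate 7 13) cover_seven"
  by code_simp

text \<open>For these k the number of right vertices is 3, 5, 7, 10 and 13, the sums for which the
  five trees are checked.\<close>

lemma not_pageable_bipartite:
  assumes "k \<in> {2, 3, 4, 5, 6}"
    and "count_list w True = k + 1" "count_list w False = (k + 1)^2 div 4 + 1"
  shows "\<not> pageable w k"
proof -
  have "k = 2 \<or> k = 3 \<or> k = 4 \<or> k = 5 \<or> k = 6" using assms(1) by simp
  then show ?thesis
    using not_pageable[OF certified_three length_certificates_three _ covers_three, of w]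
      not_pageable[OF certified_four length_certificates_four _ covers_four, of w]
      not_pageable[OF certified_five length_certificates_five _ covers_five, of w]
      not_pageable[OF certified_six length_certificates_six _ covers_six, of w]
      not_pageable[OF certified_seven length_certificates_seven _ covers_seven, of w]
      assms(2,3)
    by (elim disjE) simp_all
qed

section \<open>The page number\<close>

text \<open>Alternation takes four distinct positions, so edges with a common endpoint never cross,
  whatever the injective placement.\<close>

lemma book_embedding_stars: "\<exists>pos page. book_embedding (Kbip_V m n) (Kbip_E m n) m pos page"
proof -
  define pos :: "nat + nat \<Rightarrow> nat" where "pos = case_sum (\<lambda>i. i) (\<lambda>j. m + j)"
  define page :: "(nat + nat) set \<Rightarrow> nat" where "page e = (THE i. Inl i \<in> e)" for e
  have page: "page {Inl i, Inr j} = i" for i j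
    by (auto simp: page_def)
  have "inj_on pos (Kbip_V m n)"
    by (auto simp: inj_on_def Kbip_V_def pos_def)
  moreover have "\<not> crossing pos {Inl i, Inr j} {Inl i, Inr j'}" for i j j'
    by (auto simp: crossing_def doubleton_eq_iff)
  ultimately have "book_embedding (Kbip_V m n) (Kbip_E m n) m pos page"
    by (auto simp: book_embedding_def Kbip_E_def page)
  then show ?thesis by blast
qed

theorem theorem3:
  fixes k :: nat
  assumes "k \<in> {2, 3, 4, 5, 6}"
  shows "pagenumber (Kbip_V (k + 1) ((k + 1)^2 div 4 + 1))
                    (Kbip_E (k + 1) ((k + 1)^2 div 4 + 1)) = k + 1"
  unfolding pagenumber_def
proof (rule Least_equality)
  let ?n = "(k + 1)^2 div 4 + 1"
  show "\<exists>pos page. book_embedding (Kbip_V (k + 1) ?n) (Kbip_E (k + 1) ?n) (k + 1) pos page"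
    by (rule book_embedding_stars)
  fix p assume "\<exists>pos page. book_embedding (Kbip_V (k + 1) ?n) (Kbip_E (k + 1) ?n) p pos page"
  then obtain w where "count_list w True = k + 1" "count_list w False = ?n" "pageable w p"
    by (auto elim!: book_embedding_pageable)
  \<comment> \<open>An embedding in fewer pages is also one in k pages, so excluding k alone
    excludes every p \<le> k.\<close>
  then have "\<not> p \<le> k" using not_pageable_bipartite[OF assms] pageable_mono by blast
  then show "k + 1 \<le> p" by simp
qed

end
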